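(* Let $\beta>1$ be a simple Parry number with Rényi expansion of unity $d_\beta(1)=t_1t_2\cdots t_m$, $m\ge 2$, and let $u_\beta$ be the fixed point of the canonical substitution $\varphi$ associated with $\beta$. Then the factor complexity $\mathcal C$ of $u_\beta$ is an affine function (i.e. there are constants $a,b$ with $\mathcal C(n)=an+b$ for all $n\in\mathbb N$) if and only if both of the following hold: 1) $t_m=1$; 2) either $t_1\cdots t_{m-1}=w^k$ for some word $w$ and some integer $k\ge 2$, or no non-empty word is simultaneously a proper prefix and a proper suffix of the word $t_1t_2\cdots t_{m-1}$.
   Context: A simple Parry number is a real $\beta>1$ whose Rényi expansion of $1$ is finite: $d_\beta(1)=t_1\cdots t_m$ with nonnegative integer digits, $t_1=\lfloor\beta\rfloor\ge1$, $t_m\ge1$, $1=\sum_{i=1}^m t_i\beta^{-i}$. The digits satisfy the Parry condition: $t_it_{i+1}\cdots t_m0^\omega$ is lexicographically strictly smaller than $t_1\cdots t_m0^\omega$ for every $2\le i\le m$ (in particular $t_1\ge t_i$ for all $i$). The canonical substitution on the alphabet $\mathcal A=\{0,1,\dots,m-1\}$ is $\varphi(k)=0^{t_{k+1}}(k+1)$ for $0\le k\le m-2$ and $\varphi(m-1)=0^{t_m}$; it is primitive and $u_\beta=\lim_{n\to\infty}\varphi^n(0)$ is its unique fixed point. The factor complexity is $\mathcal C(n)=$ the number of distinct factors (finite contiguous subwords) of $u_\beta$ of length $n$. Words here are finite sequences of digits; $w^k$ denotes the concatenation of $k$ copies of $w$. *)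

theory Defs
  imports Complex_Main "HOL-Library.Sublist"
begin

(* Digits are given as a list t = [t_1, ..., t_m]; t_i = t ! (i-1). *)

definition pad_zero :: "nat list \<Rightarrow> nat \<Rightarrow> nat" where
  "pad_zero t j = (if j < length t then t ! j else 0)"

definition lex_less_seq :: "(nat \<Rightarrow> nat) \<Rightarrow> (nat \<Rightarrow> nat) \<Rightarrow> bool" where
  "lex_less_seq a b \<longleftrightarrow> (\<exists>k. (\<forall>j<k. a j = b j) \<and> a k < b k)"

definition simple_parry :: "real \<Rightarrow> nat list \<Rightarrow> bool" where
  "simple_parry \<beta> t \<longleftrightarrow>
     \<beta> > 1 \<and> length t \<ge> 1 \<and>
     int (t ! 0) = \<lfloor>\<beta>\<rfloor> \<and> t ! 0 \<ge> 1 \<and> last t \<ge> 1 \<and>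
     (\<Sum>i<length t. real (t ! i) / \<beta> ^ (i + 1)) = 1 \<and>
     (\<forall>i. 1 \<le> i \<and> i < length t \<longrightarrow>
        lex_less_seq (pad_zero (drop i t)) (pad_zero t))"

definition canon_subst :: "nat list \<Rightarrow> nat \<Rightarrow> nat list" where
  "canon_subst t k =
     (if k + 1 < length t then replicate (t ! k) 0 @ [k + 1]
      else replicate (t ! (length t - 1)) 0)"

definition subst_word :: "nat list \<Rightarrow> nat list \<Rightarrow> nat list" where
  "subst_word t w = concat (map (canon_subst t) w)"

(* u_beta = lim phi^n(0): the letter at position n is read off phi^(n+1)(0),
   which has length > n and is a prefix of all later iterates *)
definition u_beta :: "nat list \<Rightarrow> nat \<Rightarrow> nat" where
  "u_beta t n = ((subst_word t ^^ Suc n) [0]) ! n"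

definition factors :: "(nat \<Rightarrow> nat) \<Rightarrow> nat \<Rightarrow> nat list set" where
  "factors u n = {map u [i..<i + n] | i. True}"

definition complexity :: "(nat \<Rightarrow> nat) \<Rightarrow> nat \<Rightarrow> nat" where
  "complexity u n = card (factors u n)"

end

theory Submission
  imports Defs
begin

text \<open>
  The images of distinct letters end in distinct letters, so the substitution rotates left
  extensions and every prefix of the fixed point is preceded by all \<open>m\<close> letters. Hence the
  complexity is affine iff no other factor is left special. If \<open>t\<^sub>m \<ge> 2\<close>, the zeros of length
  \<open>t\<^sub>1 + 1\<close> form such a factor.

  Let \<open>t\<^sub>m = 1\<close>. A later position of the fixed point agrees with its beginning for some length
  \<open>L\<close> and then shows a letter \<open>b\<close> instead of \<open>c\<close>. Applying the substitution, the two letters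
  compete by the lengths of the zero runs they produce: the letter with the shorter run is
  increased by one, the other one becomes \<open>0\<close>, and both are increased if the runs agree. All such
  branches arise in this way from positions inside an image, which are preceded by \<open>0\<close>. Two
  branches with different left letters can merge only if two different letters \<open>b\<close> at the same
  \<open>L\<close> both lose against \<open>c\<close>. By the Parry condition only a letter \<open>m - 1\<close>, or a letter that
  descends from one, can lose; the second \<open>m - 1\<close> comes from a border of \<open>t\<^sub>1\<dots>t\<^sub>m\<^sub>-\<^sub>1\<close>, and if
  this word is a power then the older letter never loses again. If the word is bordered but not
  a power, let \<open>x\<close> be its shortest border and \<open>q\<close> maximal such that \<open>x\<^sup>q\<close> is a suffix. The letters
  just before the last \<open>q\<close> and \<open>q - 1\<close> copies of \<open>x\<close> start two branches that merge.
\<close>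

section \<open>The fixed point\<close>

lemma nth_concat_replicate:
  "i < k * length w \<Longrightarrow> concat (replicate k w) ! i = w ! (i mod length w)"
proof (induction k arbitrary: i)
  case (Suc k)
  show ?case
  proof (cases "i < length w")
    case False
    then have "i - length w < k * length w" "(i - length w) mod length w = i mod length w"
      using Suc.prems by (auto simp: le_mod_geq)
    then show ?thesis using False Suc.IH[of "i - length w"] by (simp add: nth_append)
  qed (simp add: nth_append)
qed simp

lemma mod_add_neq:
  assumes "(a::nat) \<le> m" "b \<le> m" "a \<noteq> b" shows "(a + k) mod Suc m \<noteq> (b + k) mod Suc m"
proof
  assume "(a + k) mod Suc m = (b + k) mod Suc m"
  then obtain p q where "a + k + Suc m * p = b + k + Suc m * q" by (auto simp: nat_mod_eq_iff)
  then have "a + Suc m * p = b + Suc m * q" by simp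
  then have "(a + Suc m * p) mod Suc m = (b + Suc m * q) mod Suc m" by simp
  then show False using assms by (simp only: mod_mult_self2) simp
qed

section \<open>The canonical substitution and the positions of its images\<close>

locale parry_digits =
  fixes t :: "nat list"
  assumes len: "2 \<le> length t"
    and fst_pos: "1 \<le> t ! 0"
    and last_pos: "1 \<le> last t"
    and parry: "\<lbrakk>1 \<le> i; i < length t\<rbrakk> \<Longrightarrow> lex_less_seq (pad_zero (drop i t)) (pad_zero t)"
begin

text \<open>The largest letter. It is also the length of \<open>butlast t\<close>, so a letter
  \<open>x\<close> doubles as the length of a prefix of that word.\<close>

definition M :: nat where "M = length t - 1"

abbreviation u :: "nat \<Rightarrow> nat" where "u \<equiv> u_beta t"

abbreviation img :: "nat \<Rightarrow> nat list" where "img \<equiv> canon_subst t"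

text \<open>Indexing starts at zero: \<open>P x\<close> is the digit with index
  \<open>x + 1\<close>, hence the number of zeros in the image of the letter
  \<open>x\<close>.\<close>

abbreviation P :: "nat \<Rightarrow> nat" where "P \<equiv> (!) t"

lemma M_pos: "1 \<le> M"
  using len by (simp add: M_def)

lemma last_eq: "last t = P M"
  using len unfolding M_def by (intro last_conv_nth) auto

lemma img_below: "x < M \<Longrightarrow> img x = replicate (P x) 0 @ [x + 1]"
  using len by (auto simp: canon_subst_def M_def)

lemma img_M: "img M = replicate (last t) 0"
  using last_eq by (simp add: canon_subst_def M_def)

lemma length_img_pos: "1 \<le> length (img x)"
  using last_pos last_eq by (auto simp: canon_subst_def M_def)

lemma subst_word_append: "subst_word t (v @ w) = subst_word t v @ subst_word t w"
  by (simp add: subst_word_def)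

lemma length_subst_word: "length w \<le> length (subst_word t w)"
proof (induction w)
  case (Cons a w)
  then show ?case using length_img_pos[of a] unfolding subst_word_def by (simp del: length_greater_0_conv)
qed (simp add: subst_word_def)

definition iter :: "nat \<Rightarrow> nat list" where "iter k = (subst_word t ^^ k) [0]"

lemma iter_0: "iter 0 = [0]" and iter_Suc: "iter (Suc k) = subst_word t (iter k)"
  by (simp_all add: iter_def)

lemma img_0: "img 0 = replicate (P 0) 0 @ [1]"
  using img_below[of 0] M_pos by simp

lemma prefix_iter_Suc: "prefix (iter k) (iter (Suc k))"
proof (induction k)
  case 0
  show ?case using fst_pos
    by (cases "P 0") (auto simp: iter_Suc iter_0 subst_word_def img_0)
next
  case (Suc k)
  then obtain z where "iter (Suc k) = iter k @ z" by (auto elim: prefixE)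
  then have "iter (Suc (Suc k)) = iter (Suc k) @ subst_word t z"
    by (metis iter_Suc subst_word_append)
  then show ?case by simp
qed

lemma prefix_iter: "k \<le> l \<Longrightarrow> prefix (iter k) (iter l)"
  by (induction rule: dec_induct) (auto intro: prefix_order.trans prefix_iter_Suc)

text \<open>The initial \<open>0\<close> is replaced by at least two letters because the first digit
  is positive, and the other letters never shrink.\<close>

lemma length_iter: "Suc k \<le> length (iter k)"
proof (induction k)
  case 0
  show ?case by (simp add: iter_0)
next
  case (Suc k)
  obtain z where z: "iter k = [0] @ z"
    using prefix_iter[of 0 k] by (auto simp: iter_0 elim: prefixE)
  have "length (iter (Suc k)) = Suc (P 0) + length (subst_word t z)"
    by (simp add: iter_Suc z subst_word_append) (simp add: subst_word_def img_0)
  then show ?case using Suc length_subst_word[of z] fst_pos z by simp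
qed

lemma u_iter: "i < length (iter k) \<Longrightarrow> u i = iter k ! i"
proof -
  assume i: "i < length (iter k)"
  have "u i = iter (Suc i) ! i" by (simp add: u_beta_def iter_def)
  moreover have "i < length (iter (Suc i))" using length_iter[of "Suc i"] by simp
  moreover have "prefix (iter (Suc i)) (iter k) \<or> prefix (iter k) (iter (Suc i))"
    using prefix_iter by (meson nat_le_linear)
  ultimately show ?thesis using i by (auto simp: prefix_def nth_append)
qed

lemma u_0: "u 0 = 0"
  using u_iter[of 0 0] by (simp add: iter_0)

text \<open>The image of the letter at position \<open>i\<close> starts at position \<open>pos i\<close>.\<close>

definition pos :: "nat \<Rightarrow> nat" where "pos i = (\<Sum>j<i. length (img (u j)))"

lemma pos_0: "pos 0 = 0" and pos_Suc: "pos (Suc i) = pos i + length (img (u i))"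
  by (simp_all add: pos_def)

text \<open>The fixed point equation, read by position: the part of an iterate before position
  \<open>i\<close> is mapped to a word of length \<open>pos i\<close>, and the image of
  \<open>u i\<close> follows it.\<close>

lemma u_block: assumes "k < length (img (u i))" shows "u (pos i + k) = img (u i) ! k"
proof -
  define A where "A = iter i"
  have i: "i < length A" using length_iter[of i] by (simp add: A_def)
  have nth: "\<And>j. j < length A \<Longrightarrow> A ! j = u j" by (simp add: A_def u_iter)
  have "take i A = map u [0..<i]" using i nth by (intro nth_equalityI) auto
  then have l: "length (subst_word t (take i A)) = pos i"
    by (simp add: subst_word_def length_concat pos_def comp_def sum_list_sum_nth atLeast0LessThan)
  have "A = take i A @ [u i] @ drop (Suc i) A" using i nth id_take_nth_drop[OF i] by simp
  from arg_cong[OF this, of "subst_word t"]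
  have "iter (Suc i) = subst_word t (take i A) @ subst_word t [u i] @ subst_word t (drop (Suc i) A)"
    by (simp only: subst_word_append iter_Suc A_def)
  moreover have "subst_word t [u i] = img (u i)" by (simp add: subst_word_def)
  ultimately have "iter (Suc i) = subst_word t (take i A) @ img (u i) @ subst_word t (drop (Suc i) A)"
    by simp
  then show ?thesis using assms l by (subst u_iter[of _ "Suc i"]) (auto simp: nth_append)
qed

lemma strict_mono_pos: "strict_mono pos"
  using length_img_pos by (simp add: strict_mono_Suc_iff pos_Suc Suc_le_eq)

lemma pos_less_iff: "pos i < pos j \<longleftrightarrow> i < j" and pos_eq_iff: "pos i = pos j \<longleftrightarrow> i = j"
  using strict_mono_less[OF strict_mono_pos] strict_mono_eq[OF strict_mono_pos] by auto

lemma less_pos: "1 \<le> i \<Longrightarrow> i < pos i"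
proof (induction i rule: dec_induct)
  case base
  show ?case using fst_pos by (simp add: pos_def u_0 img_0)
next
  case (step i)
  then show ?case using length_img_pos[of "u i"] by (simp add: pos_Suc)
qed

lemma block_cases: obtains i k where "p = pos i + k" "k < length (img (u i))"
proof -
  have "\<exists>i k. p = pos i + k \<and> k < length (img (u i))"
  proof (induction p)
    case 0
    have "0 = pos 0 + 0 \<and> 0 < length (img (u 0))"
      using length_img_pos[of "u 0"] unfolding pos_0 by linarith
    then show ?case by blast
  next
    case (Suc p)
    then obtain i k where ik: "p = pos i + k" "k < length (img (u i))" by blast
    show ?case
    proof (cases "Suc k < length (img (u i))")
      case True
      then have "Suc p = pos i + Suc k" using ik by simp
      then show ?thesis using True by blast
    next
      case False
      then have "Suc p = pos (Suc i) + 0" using ik by (simp add: pos_Suc)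
      then show ?thesis using length_img_pos[of "u (Suc i)"] less_le_trans[OF zero_less_one] by blast
    qed
  qed
  then show ?thesis using that by blast
qed

lemma u_le_M: "u p \<le> M"
proof -
  obtain i k where ik: "p = pos i + k" "k < length (img (u i))" by (rule block_cases)
  then have "u p \<in> set (img (u i))" using u_block by simp
  then show ?thesis by (auto simp: canon_subst_def M_def split: if_splits)
qed

text \<open>An image ends in \<open>x + 1\<close> for \<open>x < M\<close> and in \<open>0\<close>
  for \<open>x = M\<close>. This is the rotation of left letters.\<close>

lemma u_before_pos: assumes "1 \<le> i" shows "u (pos i - 1) = Suc (u (i - 1)) mod Suc M"
proof -
  obtain j where j: "i = Suc j" using assms by (cases i) auto
  let ?k = "length (img (u j)) - 1"
  have k: "?k < length (img (u j))" using length_img_pos[of "u j"] by simp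
  have "pos i - 1 = pos j + ?k" using length_img_pos[of "u j"] by (simp add: j pos_Suc)
  then have e: "u (pos i - 1) = img (u j) ! ?k" using u_block[OF k] by simp
  consider "u j < M" | "u j = M" using u_le_M[of j] by linarith
  then show ?thesis
  proof cases
    case 1
    then show ?thesis using e j by (simp add: img_below nth_append)
  next
    case 2
    then show ?thesis using e j last_pos by (simp add: img_M)
  qed
qed

lemma u_run_below:
  assumes "u i < M"
  shows "k < P (u i) \<Longrightarrow> u (pos i + k) = 0" and "u (pos i + P (u i)) = Suc (u i)"
proof -
  have "u (pos i + k) = img (u i) ! k" if "k \<le> P (u i)" for k
    using u_block[of k i] that assms by (simp add: img_below)
  then show "k < P (u i) \<Longrightarrow> u (pos i + k) = 0" "u (pos i + P (u i)) = Suc (u i)"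
    using assms by (simp_all add: img_below nth_append)
qed

lemma u_run_M: "\<lbrakk>u i = M; k < last t\<rbrakk> \<Longrightarrow> u (pos i + k) = 0"
  using u_block[of k i] by (auto simp: img_M)

lemma u_first_run: "k < P 0 \<Longrightarrow> u k = 0" and u_first_run_end: "u (P 0) = 1"
proof -
  have "u 0 < M" using u_0 M_pos by simp
  from u_run_below[OF this] show "k < P 0 \<Longrightarrow> u k = 0" "u (P 0) = 1" by (simp_all add: u_0 pos_0)
qed

lemma exists_letter: "x \<le> M \<Longrightarrow> \<exists>i. u i = x"
proof (induction x)
  case 0
  show ?case using u_0 by blast
next
  case (Suc x)
  then obtain i where "u i = x" by auto
  then show ?case using u_run_below(2)[of i] Suc.prems by auto
qed

text \<open>Only the boundary of two images is critical. There a nonzero second letter comes from a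
  letter without zeros in its image, which is itself nonzero, and the inequality is inherited from
  the preimages. The use is that \<open>M\<close> is always followed by \<open>0\<close>.\<close>

lemma u_pair: "u (Suc i) = 0 \<or> u i < u (Suc i)"
proof (induction i rule: less_induct)
  case (less p)
  obtain i k where ik: "Suc p = pos i + k" "k < length (img (u i))" by (rule block_cases)
  show ?case
  proof (cases k)
    case (Suc k')
    then have "u p = img (u i) ! k'" "u (Suc p) = img (u i) ! k"
      using ik u_block[of k' i] u_block[of k i] by auto
    then show ?thesis using ik Suc
      by (auto simp: canon_subst_def nth_append split: if_splits)
  next
    case 0
    then have "i \<noteq> 0" using ik by (cases i) (auto simp: pos_0)
    then obtain j where j: "i = Suc j" by (cases i) auto
    have "p = pos i - 1" using ik 0 by simp
    then have p: "u p = Suc (u j) mod Suc M" using u_before_pos[of i] j by simp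
    have "j < p" using less_pos[of i] ik 0 j by simp
    then have IH: "u i = 0 \<or> u j < u i" using less[of j] j by simp
    consider "u i = M" | "u i < M" "0 < P (u i)" | "u i < M" "P (u i) = 0"
      using u_le_M[of i] by linarith
    then show ?thesis
    proof cases
      case 1
      then show ?thesis using u_run_M[of i 0] last_pos ik 0 by simp
    next
      case 2
      then show ?thesis using u_run_below(1)[of i 0] ik 0 by simp
    next
      case 3
      then have "u (Suc p) = Suc (u i)" using u_run_below(2)[of i] ik 0 by simp
      moreover have "u i \<noteq> 0" using 3 fst_pos by (intro notI) simp
      ultimately show ?thesis using IH p 3 by simp
    qed
  qed
qed

lemma u_after_M: "u i = M \<Longrightarrow> u (Suc i) = 0"
  using u_pair[of i] u_le_M[of "Suc i"] by auto

lemma u_pos_agree: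
  assumes "\<And>k. k < L \<Longrightarrow> u (i + k) = u k"
  shows "l \<le> L \<Longrightarrow> pos (i + l) = pos i + pos l"
    and "k < pos L \<Longrightarrow> u (pos i + k) = u k"
proof -
  have *: "l \<le> L \<Longrightarrow> pos (i + l) = pos i + pos l" for l
  proof (induction l)
    case (Suc l)
    then show ?case using assms[of l] by (simp add: pos_Suc)
  qed (simp add: pos_0)
  then show "l \<le> L \<Longrightarrow> pos (i + l) = pos i + pos l" .
  assume k: "k < pos L"
  obtain j r where jr: "k = pos j + r" "r < length (img (u j))" by (rule block_cases)
  have "j < L" using k jr pos_less_iff[of j L] by linarith
  then have "u (i + j) = u j" "pos (i + j) = pos i + pos j" using assms[of j] *[of j] by auto
  then show "u (pos i + k) = u k" using u_block[of r j] u_block[of r "i + j"] jr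
    by (metis add.assoc)
qed

section \<open>Recurrence and left extensions of prefixes\<close>

lemma prefix_recurs: "\<exists>i\<ge>1. \<forall>k<L. u (i + k) = u k"
proof (induction L)
  case 0
  then show ?case by auto
next
  case (Suc L)
  show ?case
  proof (cases "L = 0")
    \<comment> \<open>Since \<open>pos 0 = 0\<close>, the substitution gains nothing here; a
      \<open>0\<close> away from the origin comes from the image of \<open>M\<close>.\<close>
    case True
    obtain i where i: "u i = M" using exists_letter by blast
    then have "i \<noteq> 0" using u_0 M_pos by (metis not_one_le_zero)
    then have "1 \<le> pos i" using less_pos[of i] by simp
    moreover have "u (pos i) = 0" using u_run_M[OF i, of 0] last_pos by simp
    ultimately show ?thesis using True u_0 by auto
  next
    case False
    obtain i where i: "i \<ge> 1" "\<And>k. k < L \<Longrightarrow> u (i + k) = u k" using Suc by blast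
    have "\<And>k. k < Suc L \<Longrightarrow> u (pos i + k) = u k"
      using u_pos_agree(2)[OF i(2)] less_pos[of L] False by simp
    moreover have "pos i \<ge> 1" using less_pos[OF i(1)] i(1) by simp
    ultimately show ?thesis by blast
  qed
qed

lemma prefix_left_extensions:
  assumes "a \<le> M" shows "\<exists>i\<ge>1. u (i - 1) = a \<and> (\<forall>k<L. u (i + k) = u k)"
proof -
  have shift: "\<exists>j\<ge>1. u (j - 1) = (u (i - 1) + r) mod Suc M \<and> (\<forall>k<L. u (j + k) = u k)"
    if i: "i \<ge> 1" "\<forall>k<L. u (i + k) = u k" for i r
  proof (induction r)
    case 0
    have "u (i - 1) mod Suc M = u (i - 1)" using u_le_M[of "i - 1"] by simp
    then show ?case using i by auto
  next
    case (Suc r)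
    then obtain j where j: "j \<ge> 1" "u (j - 1) = (u (i - 1) + r) mod Suc M"
      "\<And>k. k < L \<Longrightarrow> u (j + k) = u k" by blast
    have "L \<le> pos L" using less_pos[of L] by (cases "L = 0") auto
    then have "\<forall>k<L. u (pos j + k) = u k" using u_pos_agree(2)[OF j(3)] by simp
    moreover have "pos j \<ge> 1" using less_pos[OF j(1)] j(1) by simp
    moreover have "u (pos j - 1) = (u (i - 1) + Suc r) mod Suc M"
      using u_before_pos[OF j(1)] j(2) by (simp add: mod_Suc_eq)
    ultimately show ?case by blast
  qed
  obtain i where i: "i \<ge> 1" "\<forall>k<L. u (i + k) = u k" using prefix_recurs by blast
  \<comment> \<open>The number of rotations from the present left letter to \<open>a\<close>; the
    summand \<open>Suc M\<close> keeps the subtraction from truncating.\<close>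
  let ?r = "Suc M - u (i - 1) + a"
  have "(u (i - 1) + ?r) mod Suc M = (Suc M + a) mod Suc M" using u_le_M[of "i - 1"] by simp
  also have "\<dots> = a" using assms by (simp only: mod_add_self1) simp
  finally have "(u (i - 1) + ?r) mod Suc M = a" .
  then show ?thesis using shift[OF i, of ?r] by auto
qed

section \<open>Digits and branches\<close>

text \<open>The digit prefix of length \<open>c\<close> is a border of the one of length
  \<open>b\<close>; the empty border \<open>c = 0\<close> is allowed.\<close>

definition recurs :: "nat \<Rightarrow> nat \<Rightarrow> bool" where
  "recurs b c \<longleftrightarrow> c < b \<and> b \<le> M \<and> (\<forall>k<c. P (b - c + k) = P k)"

lemma recursD: "\<lbrakk>recurs b c; k < c\<rbrakk> \<Longrightarrow> P (b - c + k) = P k"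
  unfolding recurs_def by blast

text \<open>The first difference in the Parry condition for the shift \<open>b - c\<close> cannot
  lie before index \<open>c\<close>, so the shifted digit at \<open>c\<close> is at most the
  original one.\<close>

lemma recurs_le: assumes "recurs b c" "b < M" shows "P b \<le> P c"
proof -
  let ?i = "b - c"
  have i: "1 \<le> ?i" "?i < length t" and eq: "\<And>k. k < c \<Longrightarrow> P (?i + k) = P k"
    using assms by (auto simp: recurs_def M_def)
  obtain k where k: "\<And>j. j < k \<Longrightarrow> pad_zero (drop ?i t) j = pad_zero t j"
    "pad_zero (drop ?i t) k < pad_zero t k"
    using parry[OF i] by (auto simp: lex_less_seq_def)
  have val: "pad_zero (drop ?i t) j = P (?i + j) \<and> pad_zero t j = P j" if "j \<le> c" for j
    using that assms by (auto simp: pad_zero_def recurs_def M_def)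
  have "\<not> k < c" using k(2) val[of k] eq[of k] by auto
  then consider "c < k" | "c = k" by linarith
  then have "P (?i + c) \<le> P c" using k val[of c] by cases auto
  then show ?thesis using assms by (simp add: recurs_def)
qed

lemma digit_le_first: "x < M \<Longrightarrow> P x \<le> P 0"
  using recurs_le[of x 0] by (cases "x = 0") (auto simp: recurs_def)

lemma recurs_Suc: "\<lbrakk>recurs b c; b < M; P b = P c\<rbrakk> \<Longrightarrow> recurs (Suc b) (Suc c)"
  by (auto simp: recurs_def less_Suc_eq)

definition branch :: "nat \<Rightarrow> nat \<Rightarrow> nat \<Rightarrow> bool" where
  "branch a L b \<longleftrightarrow>
     (\<exists>i\<ge>1. u (i - 1) = a \<and> (\<forall>k<L. u (i + k) = u k) \<and> u (i + L) = b \<and> b \<noteq> u L)"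

lemma branch_bounds: "branch a L b \<Longrightarrow> a \<le> M \<and> b \<le> M \<and> b \<noteq> u L"
  using u_le_M by (auto simp: branch_def)

section \<open>Complexity and left special factors\<close>

abbreviation pref :: "nat \<Rightarrow> nat list" where "pref k \<equiv> map u [0..<k]"

lemma window_in_factors: "map u [i..<i + k] \<in> factors u k"
  by (auto simp: factors_def)

lemma window_Suc: "map u [i..<i + Suc k] = u i # map u [Suc i..<Suc i + k]"
  by (simp add: upt_conv_Cons del: upt_Suc)

lemma Cons_factor_iff:
  "a # f \<in> factors u (Suc k) \<longleftrightarrow> (\<exists>i\<ge>1. u (i - 1) = a \<and> f = map u [i..<i + k])"
proof
  assume "a # f \<in> factors u (Suc k)"
  then obtain i where "a # f = map u [i..<i + Suc k]" by (auto simp: factors_def)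
  then have "u (Suc i - 1) = a \<and> f = map u [Suc i..<Suc i + k]" unfolding window_Suc by simp
  then show "\<exists>i\<ge>1. u (i - 1) = a \<and> f = map u [i..<i + k]" by (intro exI[of _ "Suc i"]) simp
next
  assume "\<exists>i\<ge>1. u (i - 1) = a \<and> f = map u [i..<i + k]"
  then obtain i where i: "i \<ge> 1" "u (i - 1) = a" "f = map u [i..<i + k]" by blast
  then have "a # f = map u [i - 1..<i - 1 + Suc k]" unfolding window_Suc by simp
  then show "a # f \<in> factors u (Suc k)" using window_in_factors[of "i - 1" "Suc k"] by (simp only:)
qed

lemma tail_in_factors: "a # f \<in> factors u (Suc k) \<Longrightarrow> f \<in> factors u k"
  by (auto simp: Cons_factor_iff window_in_factors)

lemma finite_factors: "finite (factors u k)"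
proof (rule finite_subset)
  show "factors u k \<subseteq> {xs. set xs \<subseteq> {..M} \<and> length xs = k}"
    using u_le_M by (auto simp: factors_def)
qed (simp add: finite_lists_length_eq)

lemma map_u_eq_pref: "map u [i..<i + k] = pref k \<longleftrightarrow> (\<forall>j<k. u (i + j) = u j)"
  by (auto simp: list_eq_iff_nth_eq)

lemma pref_in_factors: "pref k \<in> factors u k"
  unfolding factors_def by (metis (mono_tags, lifting) add_0 mem_Collect_eq)

definition left_ext :: "nat \<Rightarrow> nat list \<Rightarrow> nat set" where
  "left_ext k f = {a. a # f \<in> factors u (Suc k)}"

lemma left_ext_pref: "left_ext k (pref k) = {..M}"
proof
  show "left_ext k (pref k) \<subseteq> {..M}" using u_le_M by (auto simp: left_ext_def Cons_factor_iff)
  show "{..M} \<subseteq> left_ext k (pref k)"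
  proof
    fix a assume "a \<in> {..M}"
    then obtain i where "i \<ge> 1" "u (i - 1) = a" "\<forall>j<k. u (i + j) = u j"
      using prefix_left_extensions[of a k] by auto
    then show "a \<in> left_ext k (pref k)"
      using map_u_eq_pref[of i k] by (auto simp: left_ext_def Cons_factor_iff intro!: exI[of _ i])
  qed
qed

lemma finite_left_ext: "finite (left_ext k f)"
  by (rule finite_subset[of _ "{..M}"]) (use u_le_M in \<open>auto simp: left_ext_def Cons_factor_iff\<close>)

lemma left_ext_nonempty: "f \<in> factors u k \<Longrightarrow> left_ext k f \<noteq> {}"
proof -
  assume "f \<in> factors u k"
  then obtain i where i: "f = map u [i..<i + k]" by (auto simp: factors_def)
  show ?thesis
  proof (cases "i = 0")
    case True
    then show ?thesis using left_ext_pref[of k] i by auto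
  next
    case False
    then have "u (i - 1) \<in> left_ext k f" using i by (auto simp: left_ext_def Cons_factor_iff)
    then show ?thesis by blast
  qed
qed

text \<open>Factors of length \<open>Suc k\<close> are grouped by their tails; the prefix
  contributes all \<open>Suc M\<close> letters.\<close>

lemma complexity_Suc:
  "complexity u (Suc k) = Suc M + (\<Sum>f\<in>factors u k - {pref k}. card (left_ext k f))"
proof -
  have "factors u (Suc k) = (\<lambda>(f, a). a # f) ` Sigma (factors u k) (left_ext k)" (is "?A = ?B")
  proof
    show "?A \<subseteq> ?B"
    proof
      fix v assume v: "v \<in> ?A"
      then obtain a f where af: "v = a # f" by (cases v) (auto simp: factors_def)
      then have "f \<in> factors u k" using v tail_in_factors by blast
      then show "v \<in> ?B" using af v by (auto simp: left_ext_def)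
    qed
    show "?B \<subseteq> ?A" by (auto simp: left_ext_def)
  qed
  moreover have "inj_on (\<lambda>(f, a). a # f) (Sigma (factors u k) (left_ext k))"
    by (auto simp: inj_on_def)
  ultimately have "complexity u (Suc k) = (\<Sum>f\<in>factors u k. card (left_ext k f))"
    using finite_factors finite_left_ext by (simp add: complexity_def card_image card_SigmaI)
  also have "\<dots> = card (left_ext k (pref k)) + (\<Sum>f\<in>factors u k - {pref k}. card (left_ext k f))"
    using finite_factors pref_in_factors by (rule sum.remove)
  finally show ?thesis by (simp add: left_ext_pref)
qed

lemma complexity_eq_card_Suc: "complexity u k = Suc (card (factors u k - {pref k}))"
  unfolding complexity_def by (rule card.remove[OF finite_factors pref_in_factors])

lemma complexity_0: "complexity u 0 = 1"
  by (simp add: complexity_def factors_def)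

definition left_special :: "nat \<Rightarrow> nat list \<Rightarrow> bool" where
  "left_special k f \<longleftrightarrow>
     (\<exists>a1 a2. a1 \<noteq> a2 \<and> a1 # f \<in> factors u (Suc k) \<and> a2 # f \<in> factors u (Suc k))"

lemma affine_if_no_left_special:
  assumes "\<And>k f. left_special k f \<Longrightarrow> f = pref k"
  shows "complexity u k = M * k + 1"
proof (induction k)
  case (Suc k)
  have "card (left_ext k f) = 1" if f: "f \<in> factors u k - {pref k}" for f
  proof -
    obtain a where a: "a \<in> left_ext k f" using left_ext_nonempty f by blast
    moreover have "b = a" if "b \<in> left_ext k f" for b
    proof (rule ccontr)
      assume "b \<noteq> a"
      then have "left_special k f" using a that by (auto simp: left_special_def left_ext_def)
      then show False using assms f by blast
    qed
    ultimately have "left_ext k f = {a}" by blast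
    then show ?thesis by simp
  qed
  then have "complexity u (Suc k) = M + complexity u k"
    using complexity_Suc[of k] complexity_eq_card_Suc[of k] by simp
  then show ?case using Suc by simp
qed (simp add: complexity_0)

text \<open>The values at 0 and 1 force the slope \<open>M\<close>, but the prefix together with a
  second left special factor makes some increment larger than \<open>M\<close>.\<close>

lemma not_affine_if_left_special:
  assumes f: "left_special k f" "f \<noteq> pref k"
  shows "\<not> (\<exists>a b :: real. \<forall>n. real (complexity u n) = a * real n + b)"
proof
  assume "\<exists>a b :: real. \<forall>n. real (complexity u n) = a * real n + b"
  then obtain a b :: real where ab: "\<And>n. real (complexity u n) = a * real n + b" by blast
  have e: "factors u 0 - {pref 0} = {}" by (auto simp: factors_def)
  have "complexity u (Suc 0) = Suc M" unfolding complexity_Suc e by simp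
  then have "a = real M" using ab[of 0] ab[of "Suc 0"] complexity_0 by simp
  then have "real (complexity u (Suc k)) = real (complexity u k) + real M"
    using ab[of k] ab[of "Suc k"] by (simp add: algebra_simps)
  then have C: "complexity u (Suc k) = complexity u k + M" by linarith
  obtain a1 a2 where a: "a1 \<noteq> a2" "{a1, a2} \<subseteq> left_ext k f"
    using f by (auto simp: left_special_def left_ext_def)
  let ?F = "factors u k - {pref k}"
  have fF: "f \<in> ?F" using f tail_in_factors by (auto simp: left_special_def)
  have fin: "finite ?F" using finite_factors by simp
  have "card {a1, a2} \<le> card (left_ext k f)" by (rule card_mono[OF finite_left_ext a(2)])
  then have 2: "2 \<le> card (left_ext k f)" using a by simp
  have "1 \<le> card (left_ext k g)" if "g \<in> ?F" for g
    using left_ext_nonempty[of g k] finite_left_ext[of k g] that by (simp add: Suc_le_eq card_gt_0_iff)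
  then have "(\<Sum>g\<in>?F - {f}. 1) \<le> (\<Sum>g\<in>?F - {f}. card (left_ext k g))"
    by (intro sum_mono) blast
  then have "card (?F - {f}) + 2 \<le> (\<Sum>g\<in>?F. card (left_ext k g))"
    using 2 sum.remove[OF fin fF, of "\<lambda>g. card (left_ext k g)"] by simp
  then have "card ?F + 1 \<le> (\<Sum>g\<in>?F. card (left_ext k g))"
    using card.remove[OF fin fF] by simp
  then show False using C complexity_Suc[of k] complexity_eq_card_Suc[of k] by simp
qed

section \<open>Necessity of the last digit being one\<close>

lemma left_special_zeros:
  assumes "2 \<le> last t" shows "left_special (Suc (P 0)) (replicate (Suc (P 0)) 0)"
proof -
  define k where "k = Suc (P 0)"
  obtain i where i: "u i = M" using exists_letter by blast
  have i': "u (Suc i) = 0" "pos (Suc i) = pos i + last t"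
    using u_after_M[OF i] by (simp_all add: pos_Suc i img_M)
  have z: "u (pos i + j) = 0" if "j < last t + P 0" for j
  proof (cases "j < last t")
    case True
    then show ?thesis using u_run_M[OF i] by simp
  next
    case False
    then obtain l where "j = last t + l" by (metis le_Suc_ex not_less)
    then show ?thesis using u_run_below(1)[of "Suc i" l] i' that M_pos by (simp add: add.assoc)
  qed
  define Z where "Z p \<longleftrightarrow> (\<forall>j<k. u (p + j) = 0)" for p
  have Zf: "map u [p..<p + k] = replicate k 0" if "Z p" for p
    using that by (intro nth_equalityI) (auto simp: Z_def)
  \<comment> \<open>The zeros from the image of \<open>M\<close> and of the \<open>0\<close> after
    it number at least \<open>P 0 + 2\<close>, so this window is also preceded by a zero.\<close>
  have "Z (Suc (pos i))" unfolding Z_def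
  proof (intro allI impI)
    fix j assume "j < k"
    then show "u (Suc (pos i) + j) = 0" using z[of "Suc j"] assms by (simp add: k_def)
  qed
  then obtain p where p: "Z p" "\<And>q. q < p \<Longrightarrow> \<not> Z q" using exists_least_iff[of Z] by blast
  have "\<not> Z 0" using u_first_run_end by (auto simp: Z_def k_def)
  then have p1: "1 \<le> p" using p(1) by (cases p) auto
  \<comment> \<open>If the first window of zeros were preceded by a zero, the window one place
    earlier would be one too.\<close>
  have "u (p - 1) \<noteq> 0"
  proof
    assume "u (p - 1) = 0"
    then have "u (p - 1 + j) = 0" if "j < k" for j
      using p(1) p1 that unfolding Z_def by (cases j) auto
    then have "Z (p - 1)" unfolding Z_def by blast
    then show False using p(2)[of "p - 1"] p1 by simp
  qed
  moreover have "u (p - 1) # replicate k 0 \<in> factors u (Suc k)"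
    using Zf[OF p(1)] p1 unfolding Cons_factor_iff by (intro exI[of _ p]) simp
  moreover have "0 # replicate k 0 \<in> factors u (Suc k)"
    using Zf[OF \<open>Z (Suc (pos i))\<close>] z[of 0] assms unfolding Cons_factor_iff
    by (intro exI[of _ "Suc (pos i)"]) simp
  ultimately have "left_special k (replicate k 0)" unfolding left_special_def by blast
  then show ?thesis by (simp only: k_def)
qed

lemma last_one_if_affine:
  assumes "\<exists>a b :: real. \<forall>n. real (complexity u n) = a * real n + b"
  shows "last t = 1"
proof (rule ccontr)
  assume "last t \<noteq> 1"
  then have "left_special (Suc (P 0)) (replicate (Suc (P 0)) 0)"
    using left_special_zeros last_pos by simp
  moreover have "replicate (Suc (P 0)) 0 \<noteq> pref (Suc (P 0))"
  proof
    assume "replicate (Suc (P 0)) 0 = pref (Suc (P 0))"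
    then have "replicate (Suc (P 0)) 0 ! P 0 = pref (Suc (P 0)) ! P 0" by simp
    then show False using u_first_run_end by (simp del: upt_Suc replicate_Suc)
  qed
  ultimately show False using not_affine_if_left_special assms by blast
qed

text \<open>A left special factor is cut at its first difference from the prefix; conversely the
  common prefix followed by \<open>b\<close> is left special.\<close>

lemma left_special_iff_collision:
  "(\<exists>k f. left_special k f \<and> f \<noteq> pref k) \<longleftrightarrow>
   (\<exists>a1 a2 L b. a1 \<noteq> a2 \<and> branch a1 L b \<and> branch a2 L b)"
proof
  assume "\<exists>k f. left_special k f \<and> f \<noteq> pref k"
  then obtain k f a1 a2 where f: "a1 \<noteq> a2" "a1 # f \<in> factors u (Suc k)"
    "a2 # f \<in> factors u (Suc k)" "f \<noteq> pref k" by (auto simp: left_special_def)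
  then have "f \<in> factors u k" using tail_in_factors by blast
  then have len: "length f = k" by (auto simp: factors_def)
  have "\<exists>j<k. f ! j \<noteq> u j" using f(4) len by (auto simp: list_eq_iff_nth_eq)
  then obtain L where L: "L < k \<and> f ! L \<noteq> u L" "\<And>j. j < L \<Longrightarrow> \<not> (j < k \<and> f ! j \<noteq> u j)"
    using exists_least_iff[of "\<lambda>j. j < k \<and> f ! j \<noteq> u j"] by blast
  have "branch a L (f ! L)" if af: "a # f \<in> factors u (Suc k)" for a
  proof -
    obtain i where i: "i \<ge> 1" "u (i - 1) = a" "f = map u [i..<i + k]"
      using af by (auto simp: Cons_factor_iff)
    have "u (i + j) = f ! j" if "j < k" for j using that i by simp
    then show ?thesis unfolding branch_def using L i(1,2) by (intro exI[of _ i]) auto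
  qed
  then show "\<exists>a1 a2 L b. a1 \<noteq> a2 \<and> branch a1 L b \<and> branch a2 L b" using f by blast
next
  assume "\<exists>a1 a2 L b. a1 \<noteq> a2 \<and> branch a1 L b \<and> branch a2 L b"
  then obtain a1 a2 L b where b: "a1 \<noteq> a2" "branch a1 L b" "branch a2 L b" by blast
  have "a # pref L @ [b] \<in> factors u (Suc (Suc L))" if "branch a L b" for a
  proof -
    obtain i where i: "i \<ge> 1" "u (i - 1) = a" "\<forall>k<L. u (i + k) = u k" "u (i + L) = b"
      using \<open>branch a L b\<close> by (auto simp: branch_def)
    then have "pref L @ [b] = map u [i..<i + Suc L]" using map_u_eq_pref[of i L] by simp
    then show ?thesis unfolding Cons_factor_iff using i by blast
  qed
  then have "left_special (Suc L) (pref L @ [b])" using b unfolding left_special_def by blast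
  moreover have "pref L @ [b] \<noteq> pref (Suc L)" using branch_bounds[OF b(2)] by simp
  ultimately show "\<exists>k f. left_special k f \<and> f \<noteq> pref k" by blast
qed

lemma affine_iff_no_collision:
  "(\<exists>a b :: real. \<forall>n. real (complexity u n) = a * real n + b) \<longleftrightarrow>
   \<not> (\<exists>a1 a2 L b. a1 \<noteq> a2 \<and> branch a1 L b \<and> branch a2 L b)"
proof
  assume "\<exists>a b :: real. \<forall>n. real (complexity u n) = a * real n + b"
  then show "\<not> (\<exists>a1 a2 L b. a1 \<noteq> a2 \<and> branch a1 L b \<and> branch a2 L b)"
    using not_affine_if_left_special left_special_iff_collision by blast
next
  assume "\<not> (\<exists>a1 a2 L b. a1 \<noteq> a2 \<and> branch a1 L b \<and> branch a2 L b)"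
  then have "\<And>k f. left_special k f \<Longrightarrow> f = pref k" using left_special_iff_collision by blast
  then have "\<forall>n. complexity u n = M * n + 1" using affine_if_no_left_special by blast
  then have "\<forall>n. real (complexity u n) = real M * real n + 1" by simp
  then show "\<exists>a b :: real. \<forall>n. real (complexity u n) = a * real n + b" by blast
qed

end

section \<open>Evolution of branches\<close>

locale unit_parry_digits = parry_digits +
  assumes last_one: "last t = 1"
begin

text \<open>
  The number of zeros that the image of \<open>x\<close> starts with inside the fixed point. Since \<open>M\<close> is always
  followed by \<open>0\<close>, its image \<open>0\<close> is followed by \<open>t\<^sub>1\<close> further zeros.
\<close>

definition run :: "nat \<Rightarrow> nat" where "run x = (if x < M then P x else Suc (P 0))"

lemma run_le: "x < M \<Longrightarrow> run x \<le> P 0"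
  using digit_le_first by (simp add: run_def)

lemma run_M: "run M = Suc (P 0)"
  by (simp add: run_def)

lemma run_neq_M: "\<lbrakk>x \<le> M; x \<noteq> M\<rbrakk> \<Longrightarrow> run x < run M"
  using run_le[of x] run_M by simp

lemma u_run: "k < run (u i) \<Longrightarrow> u (pos i + k) = 0"
  and u_run_end: "u (pos i + run (u i)) = (if u i < M then Suc (u i) else 1)"
proof -
  consider "u i < M" | "u i = M" using u_le_M[of i] by linarith
  then have "(\<forall>k<run (u i). u (pos i + k) = 0) \<and>
    u (pos i + run (u i)) = (if u i < M then Suc (u i) else 1)"
  proof cases
    case 1
    then show ?thesis using u_run_below[of i] by (simp add: run_def)
  next
    case 2
    have nxt: "u (Suc i) = 0" "pos (Suc i) = Suc (pos i)"
      using u_after_M 2 by (auto simp: pos_Suc img_M last_one)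
    have "u (pos i + k) = 0" if "k < run M" for k
      using u_run_M[OF 2, of 0] u_run_below(1)[of "Suc i" "k - 1"] nxt that M_pos last_one
      by (cases k) (auto simp: run_M)
    moreover have "u (pos i + run M) = 1"
      using u_run_below(2)[of "Suc i"] nxt M_pos by (simp add: run_M)
    ultimately show ?thesis using 2 by simp
  qed
  then show "k < run (u i) \<Longrightarrow> u (pos i + k) = 0"
    "u (pos i + run (u i)) = (if u i < M then Suc (u i) else 1)" by auto
qed

text \<open>The letter on the side of \<open>b\<close> where the images of the competing letters
  \<open>b\<close> and \<open>c\<close> separate. The value \<open>Suc M\<close> does not arise
  against a different letter, because \<open>run M\<close> exceeds all other runs.\<close>

definition step_letter :: "nat \<Rightarrow> nat \<Rightarrow> nat" where
  "step_letter b c = (if run b \<le> run c then Suc b else 0)"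

definition step_len :: "nat \<Rightarrow> nat \<Rightarrow> nat" where
  "step_len L b = pos L + min (run b) (run (u L))"

lemma u_min_run:
  assumes "u i = b" "c \<le> M" "c \<noteq> b"
  shows "u (pos i + min (run b) (run c)) = step_letter b c"
proof -
  have b: "b \<le> M" using assms u_le_M by blast
  show ?thesis
  proof (cases "run b \<le> run c")
    case True
    then have "b < M" using run_neq_M[of c] assms b by (cases "b = M") auto
    then show ?thesis using True u_run_end[of i] assms by (simp add: step_letter_def)
  next
    case False
    then show ?thesis using u_run[of "run c" i] assms by (simp add: step_letter_def)
  qed
qed

lemma step_letter_neq: "b \<noteq> c \<Longrightarrow> step_letter b c \<noteq> step_letter c b"
  by (auto simp: step_letter_def)

lemma u_step_len: "\<lbrakk>b \<le> M; b \<noteq> u L\<rbrakk> \<Longrightarrow> u (step_len L b) = step_letter (u L) b"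
  using u_min_run[of L "u L" b] by (simp add: step_len_def min.commute)

lemma agree_step:
  assumes agree: "\<And>k. k < L \<Longrightarrow> u (i + k) = u k" and b: "u (i + L) = b" "b \<noteq> u L"
  shows "k < step_len L b \<Longrightarrow> u (pos i + k) = u k"
    and "u (pos i + step_len L b) = step_letter b (u L)"
proof -
  have p: "pos (i + L) = pos i + pos L" using u_pos_agree(1)[OF agree] by simp
  show "u (pos i + step_len L b) = step_letter b (u L)"
    using u_min_run[OF b(1), of "u L"] b u_le_M p by (simp add: step_len_def add.assoc)
  assume k: "k < step_len L b"
  show "u (pos i + k) = u k"
  proof (cases "k < pos L")
    case True
    then show ?thesis using u_pos_agree(2)[OF agree] by simp
  next
    case False
    then obtain r where r: "k = pos L + r" by (metis le_Suc_ex not_less)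
    then have "r < run b" "r < run (u L)" using k by (auto simp: step_len_def)
    then show ?thesis using u_run[of r "i + L"] u_run[of r L] b p r by (simp add: add.assoc)
  qed
qed

section \<open>Branches under the substitution and their origin\<close>

lemma branch_step:
  assumes "branch a L b"
  shows "branch (Suc a mod Suc M) (step_len L b) (step_letter b (u L))"
proof -
  obtain i where i: "i \<ge> 1" "u (i - 1) = a" "\<And>k. k < L \<Longrightarrow> u (i + k) = u k"
    "u (i + L) = b" "b \<noteq> u L" using assms by (auto simp: branch_def)
  have "b \<le> M" using branch_bounds assms by blast
  then have "step_letter b (u L) \<noteq> u (step_len L b)"
    using u_step_len i step_letter_neq by metis
  moreover have "pos i \<ge> 1" using less_pos[OF i(1)] i(1) by simp
  ultimately show ?thesis
    using u_before_pos[OF i(1)] agree_step[OF i(3-5)] i(2) unfolding branch_def by blast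
qed

text \<open>Desubstitution. A position starting an image comes from a position that must itself
  disagree with the beginning, and its first disagreement is carried to \<open>L\<close>. A position
  inside an image is preceded by \<open>0\<close> and gives a root.\<close>

lemma branch_cases:
  assumes "branch a L b"
  obtains (root) "a = 0" "1 \<le> b" "b \<le> M" "L < P (b - 1)"
  | (step) a' L' b' where "branch a' L' b'" "a = Suc a' mod Suc M"
      "L = step_len L' b'" "b = step_letter b' (u L')"
proof -
  obtain i where i: "i \<ge> 1" "u (i - 1) = a" "\<And>k. k < L \<Longrightarrow> u (i + k) = u k"
    "u (i + L) = b" "b \<noteq> u L" using assms by (auto simp: branch_def)
  obtain j k where jk: "i = pos j + k" "k < length (img (u j))" by (rule block_cases)
  have uniq: "L' = L" if "\<And>k. k < L' \<Longrightarrow> u (i + k) = u k" "u (i + L') \<noteq> u L'" for L'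
    using that i by (metis linorder_neqE_nat)
  show ?thesis
  proof (cases k)
    case 0
    have j: "j \<ge> 1" using jk 0 i by (cases j) (auto simp: pos_0)
    have "\<exists>l. u (j + l) \<noteq> u l"
    proof (rule ccontr)
      assume "\<not> ?thesis"
      then have "\<And>l. l < Suc L \<Longrightarrow> u (j + l) = u l" by blast
      then have "u (pos j + L) = u L"
        using u_pos_agree(2)[of "Suc L" j L] less_pos[of "Suc L"] by simp
      then show False using i jk 0 by simp
    qed
    then obtain L' where L': "u (j + L') \<noteq> u L'" "\<And>l. l < L' \<Longrightarrow> u (j + l) = u l"
      using exists_least_iff[of "\<lambda>l. u (j + l) \<noteq> u l"] by blast
    let ?b = "u (j + L')"
    have br: "branch (u (j - 1)) L' ?b" using L' j by (auto simp: branch_def)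
    have ag: "\<And>k. k < step_len L' ?b \<Longrightarrow> u (i + k) = u k"
      "u (i + step_len L' ?b) = step_letter ?b (u L')"
      using agree_step[OF L'(2) refl L'(1)] jk 0 by auto
    have ne: "u (i + step_len L' ?b) \<noteq> u (step_len L' ?b)"
      using ag(2) u_step_len[OF u_le_M L'(1)] step_letter_neq[OF L'(1)] by simp
    have L: "step_len L' ?b = L" using uniq[OF ag(1) ne] by simp
    show ?thesis
      using step[OF br _ L[symmetric]] ag(2) L i u_before_pos[OF j] jk 0 by auto
  next
    case (Suc k')
    have x: "u j < M" using jk Suc u_le_M[of j] by (cases "u j = M") (auto simp: img_M last_one)
    have k: "k \<le> P (u j)" using jk x by (simp add: img_below)
    have a: "a = 0" using i(2) jk Suc k u_run_below(1)[OF x, of k'] by simp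
    let ?L = "P (u j) - k"
    \<comment> \<open>At least one zero of the run has been passed, so the rest is shorter than the
      initial run of the fixed point and its end is the first disagreement.\<close>
    have lt: "?L < P 0" using digit_le_first[OF x] Suc k by simp
    have run0: "u (i + l) = 0" if "l < ?L" for l
      using u_run_below(1)[OF x, of "k + l"] that jk by (simp add: add.assoc)
    have e: "u (i + ?L) = Suc (u j)" using u_run_below(2)[OF x] jk k by simp
    have "?L = L"
    proof (rule uniq)
      show "u (i + l) = u l" if "l < ?L" for l using run0[OF that] u_first_run lt that by simp
      show "u (i + ?L) \<noteq> u ?L" using e u_first_run[OF lt] by simp
    qed
    then show ?thesis using root a e i(4) x k Suc by auto
  qed
qed

lemma branch_root:
  assumes "x < M" "j < P x" shows "branch 0 j (Suc x)"
proof -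
  obtain i where i: "u i = x" using exists_letter assms by (meson less_imp_le)
  let ?p = "pos i + (P x - j)"
  have x: "u i < M" using i assms by simp
  have "j < P 0" using digit_le_first assms by (meson less_le_trans)
  moreover have "u (?p - 1) = 0" using u_run_below(1)[OF x, of "P x - j - 1"] i assms by simp
  moreover have "u (?p + k) = 0" if "k < j" for k
    using u_run_below(1)[OF x, of "P x - j + k"] i that assms by (simp add: add.assoc)
  moreover have "u (?p + j) = Suc x" using u_run_below(2)[OF x] i assms by simp
  moreover have "1 \<le> ?p" using assms by simp
  ultimately show ?thesis using u_first_run unfolding branch_def
    by (intro exI[of _ ?p]) auto
qed

text \<open>The letter \<open>M\<close> is followed only by \<open>0\<close>, so it cannot precede
  \<open>x\<close>. A left letter below \<open>M\<close> becomes nonzero after one rotation, hence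
  differs from that of a root.\<close>

lemma branch_empty:
  assumes "1 \<le> x" "x \<le> M" obtains a where "branch a 0 x" "a < M"
proof -
  obtain i where i: "u i = x" using exists_letter assms by blast
  then have "i \<noteq> 0" using u_0 assms by (metis not_one_le_zero)
  then obtain j where j: "i = Suc j" by (cases i) auto
  have "u j \<noteq> M" using u_after_M[of j] i j assms by auto
  then have "u j < M" using u_le_M[of j] by simp
  moreover have "branch (u j) 0 x" unfolding branch_def
    using i j assms u_0 by (intro exI[of _ i]) auto
  ultimately show ?thesis using that by blast
qed

text \<open>
  The length alone does not increase when \<open>L = 0\<close> and the run of \<open>b\<close> is empty.
\<close>

lemma branch_step_increases:
  assumes "branch a L b"
  shows "L * (M + 2) + b < step_len L b * (M + 2) + step_letter b (u L)"
proof -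
  have b: "b \<le> M" "b \<noteq> u L" using branch_bounds assms by auto
  show ?thesis
  proof (cases "L < step_len L b")
    case True
    then have "Suc L * (M + 2) \<le> step_len L b * (M + 2)" by (intro mult_le_mono1) simp
    then show ?thesis using b by simp
  next
    case False
    then have "\<not> L < pos L" by (simp add: step_len_def)
    then have L: "L = 0" using less_pos[of L] by (cases L) auto
    then have "min (run b) (run 0) = 0" using False by (auto simp: step_len_def pos_0 u_0 min_def)
    moreover have "run 0 \<noteq> 0" using fst_pos M_pos by (simp add: run_def)
    ultimately have "run b \<le> run (u L)" by (auto simp: min_def split: if_splits)
    then show ?thesis using L by (simp add: step_letter_def)
  qed
qed

text \<open>Holds for roots, which compete with \<open>0\<close>. In a step, equal runs extend the
  border by one digit, and unequal runs turn one letter into \<open>0\<close> and leave the other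
  positive.\<close>

lemma branch_related: "branch a L b \<Longrightarrow> recurs b (u L) \<or> recurs (u L) b"
proof (induction "L * (M + 2) + b" arbitrary: a L b rule: less_induct)
  case less
  from less.prems show ?case
  proof (cases rule: branch_cases)
    case root
    then have "b - 1 < M" by simp
    then have "L < P 0" using root digit_le_first less_le_trans by blast
    then have "u L = 0" by (rule u_first_run)
    then show ?thesis using root by (simp add: recurs_def)
  next
    case (step a' L' b')
    let ?c = "u L'"
    have bounds: "b' \<le> M" "b' \<noteq> ?c" "?c \<le> M" using branch_bounds[OF step(1)] u_le_M by auto
    have uL: "u L = step_letter ?c b'" using u_step_len bounds step by simp
    have *: "recurs (step_letter x y) (step_letter y x) \<or> recurs (step_letter y x) (step_letter x y)"
      if "recurs x y" for x y
    proof (cases "x < M")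
      case True
      then have r: "run x = P x" "run y = P y" using that by (auto simp: run_def recurs_def)
      show ?thesis
      proof (cases "P x = P y")
        case eq: True
        then show ?thesis using recurs_Suc[OF that True] r by (simp add: step_letter_def)
      next
        case False
        then have "P x < P y" using recurs_le[OF that True] by simp
        then show ?thesis using r True by (simp add: step_letter_def recurs_def)
      qed
    next
      case False
      then have "x = M" "y < M" using that by (auto simp: recurs_def)
      then show ?thesis using run_neq_M[of y] by (simp add: step_letter_def recurs_def)
    qed
    have "recurs b' ?c \<or> recurs ?c b'"
      using less.hyps[OF _ step(1)] branch_step_increases[OF step(1)] step by simp
    then show ?thesis using *[of b' ?c] *[of ?c b'] uL step by auto
  qed
qed

text \<open>The value of \<open>step_len L b\<close> when the run of \<open>u L\<close> is not the
  longer one. It does not depend on \<open>b\<close>, so two branches at the same \<open>L\<close>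
  stay together.\<close>

definition adv :: "nat \<Rightarrow> nat" where "adv L = pos L + run (u L)"

lemma branch_adv:
  assumes "branch a L b" "run (u L) \<le> run b"
  shows "u (adv L) = Suc (u L)"
    and "branch (Suc a mod Suc M) (adv L) (step_letter b (u L))"
    and "u L < M"
proof -
  have b: "b \<le> M" "b \<noteq> u L" using branch_bounds assms by auto
  have l: "step_len L b = adv L" using assms by (simp add: step_len_def adv_def)
  show "u (adv L) = Suc (u L)" using u_step_len[OF b] l assms by (simp add: step_letter_def)
  then show "u L < M" using u_le_M[of "adv L"] by simp
  show "branch (Suc a mod Suc M) (adv L) (step_letter b (u L))"
    using branch_step[OF assms(1)] l by simp
qed

lemma adv_inj: "\<lbrakk>adv L = adv L'; u L = u L'\<rbrakk> \<Longrightarrow> L = L'"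
  using pos_eq_iff by (simp add: adv_def)

lemma less_adv: "u L < M \<Longrightarrow> L < adv L"
  using less_pos[of L] fst_pos M_pos
  by (cases "L = 0") (auto simp: adv_def pos_0 u_0 run_def)

text \<open>A root has prefix letter \<open>0\<close>, so a positive prefix letter was produced by a
  step that increased it.\<close>

lemma branch_pred:
  assumes "branch a L b" "u L = Suc c"
  obtains a' L' b' where "branch a' L' b'" "u L' = c" "L = adv L'" "run c \<le> run b'"
    "a = Suc a' mod Suc M" "b = step_letter b' c"
  using assms(1)
proof (cases rule: branch_cases)
  case root
  then have "b - 1 < M" by simp
  then have "L < P 0" using root digit_le_first less_le_trans by blast
  then show ?thesis using u_first_run assms(2) by simp
next
  case (step a' L' b')
  have "b' \<le> M" "b' \<noteq> u L'" using branch_bounds[OF step(1)] by auto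
  then have "step_letter (u L') b' = Suc c" using u_step_len step assms by simp
  then have "run (u L') \<le> run b'" "u L' = c" by (auto simp: step_letter_def split: if_splits)
  then show ?thesis using that[OF step(1)] step by (simp add: adv_def step_len_def)
qed

section \<open>Absence of collisions\<close>

definition border :: "nat \<Rightarrow> bool" where "border s \<longleftrightarrow> 0 < s \<and> recurs M s"

text \<open>
  If removing any border from the front of the digit word leaves a prefix of it, a letter \<open>b\<close>
  satisfying this condition never produces a longer run than \<open>c\<close>, and the condition persists.
\<close>

definition lagging :: "nat \<Rightarrow> nat \<Rightarrow> bool" where
  "lagging b c \<longleftrightarrow> recurs c b \<and> (\<exists>s. border s \<and> s \<le> c \<and> c \<le> b + s)"

lemma lagging_if_suffix: "\<lbrakk>recurs M c; recurs c b\<rbrakk> \<Longrightarrow> lagging b c"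
  unfolding lagging_def border_def by (intro conjI exI[of _ c]) (auto simp: recurs_def)

text \<open>Write \<open>c = s + r\<close>. The hypothesis gives \<open>P c = P r\<close>, and it
  makes the prefix of length \<open>r\<close> a border of that of length \<open>b\<close> unless
  they coincide, so \<open>P b \<le> P r\<close>. The other inequality is the Parry condition for
  \<open>c\<close> and \<open>b\<close>.\<close>

lemma lagging_eq:
  assumes H: "\<And>s k. \<lbrakk>border s; k < M - s\<rbrakk> \<Longrightarrow> P (s + k) = P k"
    and "lagging b c" "c < M"
  shows "P b = P c"
proof -
  obtain s where s: "border s" "s \<le> c" "c \<le> b + s" and cb: "recurs c b"
    using assms by (auto simp: lagging_def)
  define r where "r = c - s"
  have r: "c = s + r" "r \<le> b" using s by (auto simp: r_def)
  have c: "P c = P r" using H[OF s(1), of r] r assms by simp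
  have "P b \<le> P r"
  proof (cases "b = r")
    case False
    have "P (b - r + k) = P k" if "k < r" for k
    proof -
      have "b - r + k < b" using that r False by simp
      then have "P (c - b + (b - r + k)) = P (b - r + k)" using cb unfolding recurs_def by blast
      moreover have "c - b + (b - r + k) = s + k" using r cb by (simp add: recurs_def)
      moreover have "P (s + k) = P k" using H[OF s(1), of k] r that assms by simp
      ultimately show ?thesis by simp
    qed
    then have "recurs b r" using False r cb by (simp add: recurs_def)
    then show ?thesis using recurs_le cb by (auto simp: recurs_def)
  qed simp
  then show ?thesis using c recurs_le[OF cb] assms by simp
qed

lemma step_letter_pos: "1 \<le> step_letter b c \<Longrightarrow> run b \<le> run c \<and> step_letter b c = Suc b"
  and step_letter_0: "step_letter b c = 0 \<Longrightarrow> run c < run b"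
  by (auto simp: step_letter_def split: if_splits)

lemma recurs_asym: "recurs b c \<Longrightarrow> \<not> recurs c b"
  by (simp add: recurs_def)

text \<open>Both branches are followed back to the last time one of the letters was
  \<open>M\<close>. There \<open>c\<close> is a border, so the other letter lags, and ties preserve
  this.\<close>

lemma branch_pair:
  assumes H: "\<And>s k. \<lbrakk>border s; k < M - s\<rbrakk> \<Longrightarrow> P (s + k) = P k"
  shows "\<lbrakk>branch a1 L b1; branch a2 L b2; b1 \<noteq> b2; \<not> recurs b1 (u L); \<not> recurs b2 (u L)\<rbrakk>
    \<Longrightarrow> lagging b1 (u L) \<or> lagging b2 (u L)"
proof (induction L arbitrary: a1 b1 a2 b2 rule: less_induct)
  case (less L)
  have nz: "u L \<noteq> 0" using less.prems branch_bounds[OF less.prems(1)] by (auto simp: recurs_def)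
  then obtain c where c: "u L = Suc c" by (cases "u L") auto
  obtain a1' L' b1' where 1: "branch a1' L' b1'" "u L' = c" "L = adv L'" "run c \<le> run b1'"
    "b1 = step_letter b1' c" using branch_pred[OF less.prems(1) c] by metis
  obtain a2' L'' b2' where 2: "branch a2' L'' b2'" "u L'' = c" "L = adv L''" "run c \<le> run b2'"
    "b2 = step_letter b2' c" using branch_pred[OF less.prems(2) c] by metis
  have L'': "L'' = L'" using adv_inj 1 2 by simp
  have neq: "b1' \<noteq> b2'" using less.prems 1 2 by auto
  have cM: "c < M" using u_le_M[of L] c by simp
  have lt: "L' < L" using less_adv 1 cM by simp
  \<comment> \<open>A letter above \<open>c\<close> other than \<open>M\<close> would have to tie
    with \<open>c\<close> and so stay above the prefix letter, which is excluded.\<close>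
  have M_or_small: "b' = M \<and> recurs M c \<or> recurs c b'"
    if "branch a' L' b'" "run c \<le> run b'" "\<not> recurs (step_letter b' c) (Suc c)" for a' b'
  proof -
    have "recurs b' c \<or> recurs c b'" using branch_related[OF that(1)] 1 by simp
    then consider "recurs b' c" | "recurs c b'" by blast
    then show ?thesis
    proof cases
      case b: 1
      have "b' = M"
      proof (rule ccontr)
        assume "b' \<noteq> M"
        then have "b' < M" using branch_bounds[OF that(1)] by simp
        moreover from this have "P b' = P c"
          using recurs_le[OF b] that(2) cM by (simp add: run_def)
        ultimately show False using recurs_Suc[OF b] that(3) cM
          by (simp add: step_letter_def run_def)
      qed
      then show ?thesis using b by simp
    qed simp
  qed
  have s1: "b1' = M \<and> recurs M c \<or> recurs c b1'" using M_or_small[OF 1(1,4)] less.prems 1 c by simp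
  have s2: "b2' = M \<and> recurs M c \<or> recurs c b2'"
    using M_or_small[OF 2(1)[unfolded L''] 2(4)] less.prems 2 c by simp
  have step: "lagging (step_letter b' c) (Suc c)" if "lagging b' c" for b'
  proof -
    have e: "P b' = P c" using lagging_eq[OF H that cM] .
    have "b' < M" using that by (auto simp: lagging_def recurs_def)
    then have b: "step_letter b' c = Suc b'" using e cM by (simp add: step_letter_def run_def)
    have "recurs (Suc c) (Suc b')" using recurs_Suc[of c b'] e that cM by (simp add: lagging_def)
    then show ?thesis using that unfolding b by (auto simp: lagging_def intro: le_SucI)
  qed
  have "lagging b1' c \<or> lagging b2' c"
  proof (cases "b1' = M \<or> b2' = M")
    case True
    then show ?thesis using s1 s2 lagging_if_suffix neq cM by (auto simp: recurs_def)
  next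
    case False
    then have "recurs c b1'" "recurs c b2'" using s1 s2 by auto
    then show ?thesis
      using less.IH[OF lt 1(1) 2(1)[unfolded L''] neq] recurs_asym 1(2) by auto
  qed
  then show ?case using step 1 2 c by auto
qed

text \<open>Roots all have left letter \<open>0\<close>, and otherwise the preimage is unique. For
  \<open>b > 0\<close> the length determines it; for \<open>b = 0\<close> two different preimages
  would both lose against the same \<open>c\<close>.\<close>

lemma no_collision:
  assumes H: "\<And>s k. \<lbrakk>border s; k < M - s\<rbrakk> \<Longrightarrow> P (s + k) = P k"
  shows "\<lbrakk>branch a1 L b; branch a2 L b\<rbrakk> \<Longrightarrow> a1 = a2"
proof (induction "L * (M + 2) + b" arbitrary: a1 a2 L b rule: less_induct)
  case less
  \<comment> \<open>A step ending in a positive letter \<open>b\<close> adds the whole run of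
    \<open>b - 1\<close> to the length, so below \<open>P (b - 1)\<close> there are only
    roots.\<close>
  have no_root: "a = 0" if "branch a L b" "1 \<le> b" "b \<le> M" "L < P (b - 1)" for a
    using that(1)
  proof (cases rule: branch_cases)
    case (step a' L' b')
    have b': "run b' \<le> run (u L')" "b = Suc b'"
      using step_letter_pos[of b' "u L'"] step(4) that(2) by auto
    then have "L = pos L' + P (b - 1)" using step(3) that(3) by (simp add: step_len_def run_def)
    then show ?thesis using that by simp
  qed
  from less.prems(1) show ?case
  proof (cases rule: branch_cases)
    case root
    then show ?thesis using no_root less.prems by blast
  next
    case 1: (step a1' L1 b1)
    from less.prems(2) show ?thesis
    proof (cases rule: branch_cases)
      case root
      then show ?thesis using no_root[OF less.prems(1)] by simp
    next
      case 2: (step a2' L2 b2)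
      have "L1 = L2 \<and> b1 = b2"
      proof (cases "b = 0")
        case False
        then have r: "run b1 \<le> run (u L1)" "run b2 \<le> run (u L2)" "b = Suc b1" "b = Suc b2"
          using step_letter_pos[of b1 "u L1"] step_letter_pos[of b2 "u L2"] 1(4) 2(4) by auto
        then have "pos L1 + run b1 = pos L2 + run b2" using 1(3) 2(3) by (simp add: step_len_def)
        then show ?thesis using pos_eq_iff[of L1 L2] r by simp
      next
        case True
        then obtain c where c: "u L = Suc c"
          using branch_bounds[OF less.prems(1)] by (cases "u L") auto
        have r: "run (u L1) < run b1" "run (u L2) < run b2"
          using step_letter_0 1(4) 2(4) True by metis+
        have "u L = step_letter (u L1) b1"
          using 1(3) u_step_len[of b1 L1] branch_bounds[OF 1(1)] by simp
        moreover have "u L = step_letter (u L2) b2"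
          using 2(3) u_step_len[of b2 L2] branch_bounds[OF 2(1)] by simp
        ultimately have "u L1 = c" "u L2 = c" using c r by (simp_all add: step_letter_def)
        moreover from this have L: "L1 = L2"
          using 1(3) 2(3) r pos_eq_iff[of L1 L2] by (simp add: step_len_def)
        moreover have "b1 = b2"
        proof (rule ccontr)
          assume neq: "b1 \<noteq> b2"
          have cM: "c < M" using u_le_M[of L] c by simp
          \<comment> \<open>A losing letter is \<open>M\<close> or lies below \<open>c\<close>, and
            it does not lag. If one of the two is \<open>M\<close>, then \<open>c\<close> is a
            border and the other one lags; if both lie below \<open>c\<close>,
            \<open>branch_pair\<close> applies.\<close>
          have not_big: "\<not> (recurs b c \<and> b < M)" if "run c < run b" for b
            using recurs_le[of b c] that cM by (auto simp: run_def)
          have not_lag: "\<not> lagging b c" if "run c < run b" for b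
          proof
            assume lag: "lagging b c"
            then have "b < M" by (auto simp: lagging_def recurs_def)
            then show False using lagging_eq[OF H lag cM] that cM by (simp add: run_def)
          qed
          have rel: "recurs b1 c \<or> recurs c b1" "recurs b2 c \<or> recurs c b2" "b1 \<le> M" "b2 \<le> M"
            using branch_related[OF 1(1)] branch_related[OF 2(1)] branch_bounds[OF 1(1)]
              branch_bounds[OF 2(1)] \<open>u L1 = c\<close> \<open>u L2 = c\<close> by auto
          have "\<lbrakk>\<not> recurs b1 c; \<not> recurs b2 c\<rbrakk> \<Longrightarrow> lagging b1 c \<or> lagging b2 c"
            using branch_pair[OF H 1(1) 2(1)[folded L] neq] \<open>u L1 = c\<close> by simp
          moreover have "run c < run b1" "run c < run b2" using r \<open>u L1 = c\<close> \<open>u L2 = c\<close> by auto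
          moreover from this have "recurs b1 c \<Longrightarrow> b1 = M" "recurs b2 c \<Longrightarrow> b2 = M"
            using not_big rel by (auto simp: le_less)
          ultimately show False using not_lag lagging_if_suffix rel neq by blast
        qed
        ultimately show ?thesis by simp
      qed
      moreover have "L1 * (M + 2) + b1 < L * (M + 2) + b"
        using branch_step_increases[OF 1(1)] 1(3,4) by simp
      ultimately have "a1' = a2'" using less.hyps[of L1 b1 a1' a2'] 1(1) 2(1) by simp
      then show ?thesis using 1(2) 2(2) by simp
    qed
  qed
qed

section \<open>Powers\<close>

lemma length_butlast_t: "length (butlast t) = M"
  and nth_butlast_t: "k < M \<Longrightarrow> butlast t ! k = P k"
  by (simp_all add: M_def nth_butlast)

lemma concat_replicate_eqI:
  assumes "M = k * s" "0 < s" "s \<le> M" "\<And>i. i < M \<Longrightarrow> P i = P (i mod s)"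
  shows "butlast t = concat (replicate k (take s (butlast t)))"
proof (rule nth_equalityI)
  have l: "length (take s (butlast t)) = s" using assms length_butlast_t by simp
  show "length (butlast t) = length (concat (replicate k (take s (butlast t))))"
    using l assms(1) length_butlast_t by (simp add: length_concat sum_list_replicate)
  fix i assume "i < length (butlast t)"
  then have i: "i < M" using length_butlast_t by simp
  have m: "i mod s < s" using assms by simp
  have "concat (replicate k (take s (butlast t))) ! i = take s (butlast t) ! (i mod s)"
    using nth_concat_replicate[of i k "take s (butlast t)"] l i assms(1) by simp
  also have "\<dots> = P (i mod s)" using m assms(3) nth_butlast_t[of "i mod s"] by simp
  also have "\<dots> = butlast t ! i" using assms(4)[OF i] nth_butlast_t[OF i] by simp
  finally show "butlast t ! i = concat (replicate k (take s (butlast t))) ! i" by simp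
qed

text \<open>At a first failure \<open>e\<close> the digit at \<open>s + e\<close> is too small.
  Prolonging the word periodically and comparing it with its shift by \<open>M - s\<close> then
  contradicts the Parry condition.\<close>

lemma power_border:
  assumes k: "k \<ge> 2" "butlast t = concat (replicate k w)"
    and s: "border s" and "l < M - s"
  shows "P (s + l) = P l"
proof (rule ccontr)
  define d where "d = length w"
  define X where "X i = w ! (i mod d)" for i
  have M: "M = k * d" using length_butlast_t k(2)
    by (simp add: d_def length_concat sum_list_replicate)
  have PX: "P i = X i" if "i < M" for i
    using nth_butlast_t[OF that] nth_concat_replicate[of i k w] k(2) that M
    by (simp add: X_def d_def)
  have d: "2 * d \<le> M" "0 < d" using M k(1) M_pos by (auto intro!: Nat.gr0I)
  have add: "X (i + j) = X (i + j mod d)" "X (i + j) = X (i mod d + j)" for i j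
    by (simp_all add: X_def mod_simps)
  \<comment> \<open>The Parry inequality for all shifts of the periodic sequence. Agreement over a
    full period gives equality; otherwise the shift modulo \<open>d\<close> stays within the first
    two periods, which lie in the word.\<close>
  have shift: "X (i + e) \<le> X e" if eq: "\<And>q. q < e \<Longrightarrow> X (i + q) = X q" for i e
  proof (cases "e < d")
    case False
    then have "e mod d < e" using d mod_less_divisor[of d e] by linarith
    then have "X (i + e) = X (e mod d)" using eq add(1)[of i e] by metis
    then show ?thesis by (simp add: X_def)
  next
    case True
    define j where "j = i mod d"
    have j: "j < d" "\<And>q. X (i + q) = X (j + q)" using d add by (auto simp: j_def)
    show ?thesis
    proof (cases "j = 0")
      case False
      have "P (j + q) = P q" if "q < e" for q
        using PX[of "j + q"] PX[of q] eq[OF that] j that True d by simp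
      then have "recurs (j + e) e" using False j True d by (simp add: recurs_def)
      then have "P (j + e) \<le> P e" using recurs_le j True d by simp
      then show ?thesis using PX j True d by simp
    qed (use j in simp)
  qed
  assume "P (s + l) \<noteq> P l"
  then obtain e where e: "P (s + e) \<noteq> P e \<and> e < M - s"
    and least: "\<And>q. q < e \<Longrightarrow> \<not> (P (s + q) \<noteq> P q \<and> q < M - s)"
    using exists_least_iff[of "\<lambda>l. P (s + l) \<noteq> P l \<and> l < M - s"] assms by blast
  have eq: "P (s + q) = P q" if "q < e" for q using least[OF that] that e by simp
  have sM: "0 < s" "s < M" using s by (auto simp: border_def recurs_def)
  have se: "s + e < M" using e by linarith
  then have "recurs (s + e) e" using eq sM by (simp add: recurs_def)
  then have lt: "P (s + e) < P e" using recurs_le[of "s + e" e] e se by simp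
  have MX: "X (M + q) = X q" for q by (simp add: X_def M)
  \<comment> \<open>The border gives the first \<open>s\<close> indices; the period and the
    minimality of \<open>e\<close> give the others.\<close>
  have "X (M - s + q) = X q" if q: "q < s + e" for q
  proof (cases "q < s")
    case True
    then have "P (M - s + q) = P q" using s recursD by (simp only: border_def)
    then show ?thesis using PX[of "M - s + q"] PX[of q] True sM by simp
  next
    case False
    then obtain r where r: "q = s + r" by (metis le_Suc_ex not_less)
    then have "X (s + r) = X r" using eq[of r] PX[of "s + r"] PX[of r] q se by simp
    then show ?thesis using MX[of r] r sM by simp
  qed
  then have "X (M - s + (s + e)) \<le> X (s + e)" by (rule shift)
  then show False using MX[of e] PX[of e] PX[of "s + e"] lt e sM by simp
qed

section \<open>A collision for bordered words that are not powers\<close>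

text \<open>By the Parry condition the larger letter \<open>c\<close> never has the longer run, so
  it grows, while \<open>b\<close> either ties and grows or falls to \<open>0\<close>.\<close>

lemma branch_small_step:
  assumes "branch a L b" "u L = c" "recurs c b" "c < M"
  obtains b' where "branch (Suc a mod Suc M) (adv L) b'" "u (adv L) = Suc c"
    "recurs (Suc c) b'" "b' \<le> Suc b"
proof -
  have "b < M" using assms by (simp add: recurs_def)
  then have r: "run b = P b" "run c = P c" using assms by (auto simp: run_def)
  have le: "P c \<le> P b" using recurs_le assms by blast
  have "recurs (Suc c) (step_letter b c)"
    using recurs_Suc[OF assms(3,4)] assms le r by (auto simp: step_letter_def recurs_def)
  then show ?thesis using branch_adv[OF assms(1)] le r assms that
    by (simp add: step_letter_def)
qed

lemma branch_small_steps:
  assumes "branch a L b" "u L = c" "recurs c b" "c + N \<le> M"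
  shows "u ((adv ^^ N) L) = c + N \<and>
    (\<exists>b'. branch ((a + N) mod Suc M) ((adv ^^ N) L) b' \<and> recurs (c + N) b' \<and> b' \<le> b + N)"
  using assms(4)
proof (induction N)
  case 0
  have "a mod Suc M = a" using branch_bounds[OF assms(1)] by simp
  then show ?case using assms by auto
next
  case (Suc N)
  then obtain b' where b': "u ((adv ^^ N) L) = c + N"
    "branch ((a + N) mod Suc M) ((adv ^^ N) L) b'" "recurs (c + N) b'" "b' \<le> b + N" by auto
  have "c + N < M" using Suc.prems by simp
  from branch_small_step[OF b'(2,1,3) this] obtain b'' where
    "branch (Suc ((a + N) mod Suc M) mod Suc M) (adv ((adv ^^ N) L)) b''"
    "u (adv ((adv ^^ N) L)) = Suc (c + N)" "recurs (Suc (c + N)) b''" "b'' \<le> Suc b'" by blast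
  then show ?case using b'(4) by (auto simp: mod_Suc_eq)
qed

lemma branch_fall:
  assumes "branch a L b" "u L = c" "run c < run b"
  shows "branch (Suc a mod Suc M) (adv L) 0" "u (adv L) = Suc c"
  using branch_adv[OF assms(1)] assms by (simp_all add: step_letter_def)

lemma branch_recurs_steps:
  assumes "branch a L b" "u L = 0" "1 \<le> b" "b + N \<le> M" "\<And>k. k < N \<Longrightarrow> P (b + k) = P k"
  shows "u ((adv ^^ N) L) = N \<and> branch ((a + N) mod Suc M) ((adv ^^ N) L) (b + N)"
  using assms(4,5)
proof (induction N)
  case 0
  have "a mod Suc M = a" using branch_bounds[OF assms(1)] by simp
  then show ?case using assms by auto
next
  case (Suc N)
  then have IH: "u ((adv ^^ N) L) = N" "branch ((a + N) mod Suc M) ((adv ^^ N) L) (b + N)" by auto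
  have r: "run (b + N) = run N" using Suc.prems assms(3) by (simp add: run_def)
  then show ?case using branch_adv[OF IH(2)] IH(1) by (simp add: step_letter_def mod_Suc_eq)
qed

text \<open>The first branch is the image of an empty agreement before \<open>x - 1\<close>; the
  second starts inside the longer run of \<open>y - 1\<close> with \<open>P (x - 1)\<close> zeros
  left.\<close>

lemma branch_start_pair:
  assumes "1 \<le> x" "x \<le> M" "1 \<le> y" "y \<le> M" "P (x - 1) < P (y - 1)"
  obtains a where "a \<noteq> 0" "branch a (P (x - 1)) x" "branch 0 (P (x - 1)) y" "u (P (x - 1)) = 0"
proof -
  have le: "P (y - 1) \<le> P 0" using digit_le_first assms by simp
  then have x: "1 \<le> x - 1" "x - 1 \<le> M" using assms by (auto intro!: Suc_leI Nat.gr0I)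
  obtain a where a: "branch a 0 (x - 1)" "a < M" using branch_empty[OF x] .
  have r: "run (x - 1) = P (x - 1)" "run 0 = P 0" using assms M_pos by (auto simp: run_def)
  have "branch (Suc a mod Suc M) (P (x - 1)) x"
    using branch_step[OF a(1)] r assms le x by (simp add: step_len_def step_letter_def u_0 pos_0)
  moreover have "branch 0 (P (x - 1)) y" using branch_root[of "y - 1" "P (x - 1)"] assms by simp
  moreover have "u (P (x - 1)) = 0" using u_first_run assms le by simp
  ultimately show ?thesis using that[of "Suc a"] a(2) by simp
qed

text \<open>The Parry condition keeps the runs of both letters within that of the prefix letter, so
  both grow, and equal digits keep their lengths equal.\<close>

lemma branch_parallel_steps:
  assumes "branch a1 L b1" "branch a2 L b2" "u L = 0" "1 \<le> b1" "1 \<le> b2"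
    "b1 + N \<le> M" "b2 + N \<le> M" "\<And>k. k < N \<Longrightarrow> P (b1 + k) = P (b2 + k)"
  shows "\<exists>L'. branch ((a1 + N) mod Suc M) L' (b1 + N) \<and> branch ((a2 + N) mod Suc M) L' (b2 + N) \<and>
    u L' \<le> N \<and> recurs (b1 + N) (u L')"
  using assms(6-8)
proof (induction N)
  case 0
  have "a1 mod Suc M = a1" "a2 mod Suc M = a2"
    using branch_bounds[OF assms(1)] branch_bounds[OF assms(2)] by auto
  then show ?case using assms 0 by (intro exI[of _ L]) (auto simp: recurs_def)
next
  case (Suc N)
  then obtain L' where L': "branch ((a1 + N) mod Suc M) L' (b1 + N)"
    "branch ((a2 + N) mod Suc M) L' (b2 + N)" "u L' \<le> N" "recurs (b1 + N) (u L')" by auto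
  have lt: "b1 + N < M" "u L' < M" using Suc.prems L'(3) by auto
  have r: "run (b1 + N) = P (b1 + N)" "run (b2 + N) = P (b1 + N)" "run (u L') = P (u L')"
    using Suc.prems lt by (auto simp: run_def)
  have le: "P (b1 + N) \<le> P (u L')" using recurs_le[OF L'(4) lt(1)] .
  let ?L = "step_len L' (b1 + N)"
  have l: "step_len L' (b2 + N) = ?L" using r by (simp add: step_len_def)
  have "branch ((a1 + Suc N) mod Suc M) ?L (b1 + Suc N)"
    "branch ((a2 + Suc N) mod Suc M) ?L (b2 + Suc N)"
    using branch_step[OF L'(1)] branch_step[OF L'(2)] le r l
    by (simp_all add: step_letter_def mod_Suc_eq)
  moreover have "u ?L = step_letter (u L') (b1 + N)"
    using u_step_len branch_bounds[OF L'(1)] by blast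
  moreover have "recurs (Suc (b1 + N)) (step_letter (u L') (b1 + N))"
    using recurs_Suc[OF L'(4) lt(1)] le r lt by (auto simp: step_letter_def recurs_def)
  moreover have "step_letter (u L') (b1 + N) \<le> Suc N"
    using L'(3) by (simp add: step_letter_def)
  ultimately show ?case by (metis add_Suc_right)
qed

lemma exists_collision:
  assumes "border s0" and nopow: "\<not> (\<exists>w k. k \<ge> 2 \<and> butlast t = concat (replicate k w))"
  shows "\<exists>a1 a2 L b. a1 \<noteq> a2 \<and> branch a1 L b \<and> branch a2 L b"
proof -
  obtain s where s: "border s" and least: "\<And>r. r < s \<Longrightarrow> \<not> border r"
    using exists_least_iff[of border] assms(1) by blast
  have sM: "0 < s" "s < M" using s by (auto simp: border_def recurs_def)
  have suf: "P (M - s + k) = P k" if "k < s" for k using s that recursD by (simp only: border_def)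
  have no_border: False if "0 < r" "r < s" "\<And>k. k < r \<Longrightarrow> P (M - r + k) = P k" for r
    using least[OF that(2)] that sM by (auto simp: border_def recurs_def)
  \<comment> \<open>\<open>R q\<close>: the \<open>q\<close>-th power of the shortest border is a suffix.\<close>
  define R where "R q \<longleftrightarrow> q * s \<le> M \<and> (\<forall>k<q * s. P (M - q * s + k) = P (k mod s))" for q
  have R1: "R 1" using suf sM by (simp add: R_def)
  have Rb: "q \<le> M" if "R q" for q
  proof -
    have "q * 1 \<le> q * s" using sM by (intro mult_le_mono2) simp
    then show ?thesis using that unfolding R_def by linarith
  qed
  define q where "q = Greatest R"
  have q: "R q" unfolding q_def using R1 Rb by (rule GreatestI_nat)
  have q_max: "q' \<le> q" if "R q'" for q'
    unfolding q_def using that Rb by (rule Greatest_le_nat)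
  have q1: "1 \<le> q" using q_max[OF R1] .
  define Q where "Q = q * s"
  have QM: "Q \<le> M" and Qsuf: "\<And>k. k < Q \<Longrightarrow> P (M - Q + k) = P (k mod s)"
    using q by (auto simp: R_def Q_def)
  have "Q \<noteq> M"
  proof
    assume e: "Q = M"
    then have "butlast t = concat (replicate q (take s (butlast t)))"
      using Qsuf sM by (intro concat_replicate_eqI) (auto simp: Q_def)
    moreover have "q \<noteq> 1" using e sM by (intro notI) (simp add: Q_def)
    ultimately show False using nopow q1
      by (metis Suc_1 Suc_leI le_neq_implies_less)
  qed
  then have QM: "Q < M" using QM by simp
  define Q' where "Q' = (q - 1) * s"
  have QQ': "Q = Q' + s" using q1 by (simp add: Q_def Q'_def diff_mult_distrib)
  \<comment> \<open>The same power is also a prefix: the digit at \<open>k\<close> is bounded above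
    by the one a period earlier and below by the one at the matching place in the suffix.\<close>
  have Qpre: "P k = P (k mod s)" if "k < Q" for k
    using that
  proof (induction k rule: less_induct)
    case (less k)
    show ?case
    proof (cases "k < s")
      case False
      have "P (s + r) = P r" if "r < k - s" for r
        using less.IH[of "s + r"] less.IH[of r] less.prems that by simp
      then have "recurs k (k - s)" using False less.prems QM sM by (auto simp: recurs_def)
      then have "P k \<le> P (k - s)" using recurs_le less.prems QM by simp
      moreover have "P (k - s) = P (k mod s)"
        using less.IH[of "k - s"] less.prems False sM by (simp add: le_mod_geq)
      moreover have "P (M - Q + k) \<le> P k"
      proof -
        have "P (M - Q + r) = P r" if "r < k" for r
          using Qsuf[of r] less.IH[OF that] less.prems that by simp
        then have "recurs (M - Q + k) k" using less.prems QM by (auto simp: recurs_def)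
        then show ?thesis using recurs_le[of "M - Q + k" k] less.prems QM by simp
      qed
      ultimately show ?thesis using Qsuf[OF less.prems] by simp
    qed simp
  qed
  have Q_border: "P (M - Q + k) = P k" if "k < Q" for k using Qsuf[OF that] Qpre[OF that] by simp
  \<comment> \<open>Against the prefix letter \<open>0\<close>, these letters reach \<open>M\<close>
    after \<open>Q'\<close> and \<open>Q\<close> ties respectively.\<close>
  define b1 b2 where "b1 = M - Q'" and "b2 = M - Q"
  have b: "b1 = b2 + s" "1 \<le> b2" "b1 + Q' = M" "b2 + Q = M"
    using QM QQ' by (auto simp: b1_def b2_def)
  have b2k: "P (b2 + k) = P k" if "k < Q" for k using Q_border[OF that] by (simp add: b2_def)
  have b1k: "P (b1 + k) = P k" if "k < Q'" for k
  proof -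
    have "P (b1 + k) = P ((s + k) mod s)"
      using Qsuf[of "s + k"] that QQ' b(1) by (simp add: b2_def add.assoc)
    also have "\<dots> = P k" using Qpre[of k] that QQ' by simp
    finally show ?thesis .
  qed
  \<comment> \<open>The digits read backwards from \<open>b1\<close> and \<open>b2\<close> differ after fewer than \<open>s\<close> steps, so that the
    branches started at the difference reach \<open>b1\<close> and \<open>b2\<close> against the letter \<open>0\<close>.\<close>
  have "\<exists>i. i < s \<and> i < b2 \<and> P (b1 - 1 - i) \<noteq> P (b2 - 1 - i)"
  proof (rule ccontr)
    assume "\<not> ?thesis"
    then have eq: "\<And>i. i < s \<Longrightarrow> i < b2 \<Longrightarrow> P (b1 - 1 - i) = P (b2 - 1 - i)" by blast
    show False
    \<comment> \<open>Agreement over \<open>s\<close> digits would make the power with exponent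
      \<open>q + 1\<close> a suffix; if the word is exhausted earlier, its first \<open>b2\<close>
      digits form a border shorter than \<open>s\<close>.\<close>
    proof (cases "s \<le> b2")
      case True
      have "P (M - (Q + s) + k) = P (k mod s)" if "k < Q + s" for k
      proof (cases "k < s")
        case k: True
        have "P (b2 - s + k) = P (b2 + k)"
          using eq[of "s - 1 - k"] k True b by (simp add: algebra_simps)
        also have "\<dots> = P k" using b2k[of k] k QQ' by simp
        finally show ?thesis using k by (simp add: b2_def)
      next
        case False
        then obtain r where r: "k = s + r" by (metis le_Suc_ex not_less)
        then have m: "M - (Q + s) + k = M - Q + r" using True by (simp add: b2_def)
        show ?thesis unfolding m using Qsuf[of r] r that by simp
      qed
      then have "R (Suc q)" using True QM by (simp add: R_def Q_def b2_def add.commute)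
      then show False using q_max[of "Suc q"] by simp
    next
      case False
      have "P (M - b2 + k) = P k" if k: "k < b2" for k
      proof -
        have "P k = P (b1 - b2 + k)" using eq[of "b2 - 1 - k"] k False b by simp
        also have "b1 - b2 + k = b2 + (s - b2 + k)" using b False by simp
        also have "P \<dots> = P (s - b2 + k)" using b2k[of "s - b2 + k"] k False QQ' by simp
        also have "\<dots> = P (M - s + (s - b2 + k))" using suf[of "s - b2 + k"] k False by simp
        also have "M - s + (s - b2 + k) = M - b2 + k" using False sM by simp
        finally show ?thesis by simp
      qed
      then show False using no_border[of b2] False b by simp
    qed
  qed
  then obtain i where i: "i < s \<and> i < b2 \<and> P (b1 - 1 - i) \<noteq> P (b2 - 1 - i)"
    and i_least: "\<And>j. j < i \<Longrightarrow> \<not> (j < s \<and> j < b2 \<and> P (b1 - 1 - j) \<noteq> P (b2 - 1 - j))"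
    using exists_least_iff[of "\<lambda>i. i < s \<and> i < b2 \<and> P (b1 - 1 - i) \<noteq> P (b2 - 1 - i)"] by blast
  define g1 g2 where "g1 = b1 - i" and "g2 = b2 - i"
  have g: "1 \<le> g1" "g1 \<le> M" "1 \<le> g2" "g2 \<le> M" "P (g1 - 1) \<noteq> P (g2 - 1)"
    "g1 + i = b1" "g2 + i = b2"
    using i b by (auto simp: g1_def g2_def diff_right_commute)
  obtain a1 a2 L where st: "a1 \<noteq> a2" "branch a1 L g1" "branch a2 L g2" "u L = 0"
  proof (cases "P (g1 - 1) < P (g2 - 1)")
    case True
    then show ?thesis using branch_start_pair[OF g(1-4)] that by metis
  next
    case False
    then have "P (g2 - 1) < P (g1 - 1)" using g by simp
    then show ?thesis using branch_start_pair[OF g(3,4,1,2)] that by metis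
  qed
  have "P (g1 + k) = P (g2 + k)" if "k < i" for k
    using i_least[of "i - 1 - k"] that i b by (auto simp: g1_def g2_def)
  then obtain L0 where L0: "branch ((a1 + i) mod Suc M) L0 b1" "branch ((a2 + i) mod Suc M) L0 b2"
    "u L0 \<le> i" "recurs b1 (u L0)"
    using branch_parallel_steps[OF st(2-4) g(1,3), of i] g b by auto
  \<comment> \<open>The \<open>s\<close> digits before \<open>b1\<close> are the shortest border, so
    a positive prefix letter here would be the length of a still shorter one.\<close>
  have uL0: "u L0 = 0"
  proof (rule ccontr)
    let ?c = "u L0"
    assume c: "?c \<noteq> 0"
    have cs: "?c < s" using L0 i by simp
    have "P (M - ?c + k) = P k" if k: "k < ?c" for k
    proof -
      have "P k = P (b1 - ?c + k)" using recursD[OF L0(4) k] by simp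
      also have "b1 - ?c + k = b2 + (s - ?c + k)" using b cs by simp
      also have "P \<dots> = P (s - ?c + k)" using b2k[of "s - ?c + k"] k cs QQ' by simp
      also have "\<dots> = P (M - s + (s - ?c + k))" using suf[of "s - ?c + k"] k cs by simp
      also have "M - s + (s - ?c + k) = M - ?c + k" using cs sM by simp
      finally show ?thesis by simp
    qed
    then show False using no_border c cs by blast
  qed
  define c1 c2 where "c1 = (a1 + i) mod Suc M" and "c2 = (a2 + i) mod Suc M"
  have c: "c1 \<noteq> c2" "c1 \<le> M" "c2 \<le> M"
    using mod_add_neq st branch_bounds by (auto simp: c1_def c2_def less_Suc_eq_le[symmetric])
  define LQ where "LQ = (adv ^^ Q) L0"
  have uLQ: "u LQ = Q" and br2: "branch ((c2 + Q) mod Suc M) LQ M"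
    using branch_recurs_steps[OF L0(2) uL0 b(2), of Q] b b2k by (auto simp: c2_def LQ_def)
  \<comment> \<open>This branch reaches \<open>M\<close> after \<open>Q'\<close> steps, falls to
    \<open>0\<close>, and has \<open>s - 1\<close> steps left to \<open>LQ\<close>. A positive
    letter there would again give a border shorter than \<open>s\<close>.\<close>
  have br1: "branch ((c1 + Q) mod Suc M) LQ 0"
  proof -
    have "1 \<le> b1" using b by simp
    then have Q': "u ((adv ^^ Q') L0) = Q'" "branch ((c1 + Q') mod Suc M) ((adv ^^ Q') L0) M"
      using branch_recurs_steps[OF L0(1) uL0, of Q'] b b1k by (auto simp: c1_def)
    have "run Q' < run M" using run_neq_M[of Q'] QM QQ' by simp
    from branch_fall[OF Q'(2,1) this] have f: "branch ((c1 + Suc Q') mod Suc M) ((adv ^^ Suc Q') L0) 0"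
      "u ((adv ^^ Suc Q') L0) = Suc Q'"
      by (simp_all add: mod_Suc_eq)
    have "recurs (Suc Q') 0" "Suc Q' + (s - 1) \<le> M" "Suc Q' + (s - 1) = Q"
      using QM QQ' sM by (auto simp: recurs_def)
    moreover have "(adv ^^ (s - 1)) ((adv ^^ Suc Q') L0) = LQ"
    proof -
      have "(adv ^^ (s - 1)) ((adv ^^ Suc Q') L0) = (adv ^^ (s - 1 + Suc Q')) L0"
        by (simp only: funpow_add o_apply)
      also have "s - 1 + Suc Q' = Q" using QQ' sM by simp
      finally show ?thesis by (simp add: LQ_def)
    qed
    ultimately obtain b' where b': "branch (((c1 + Suc Q') mod Suc M + (s - 1)) mod Suc M) LQ b'"
      "recurs Q b'" "b' \<le> s - 1"
      using branch_small_steps[OF f, of "s - 1"] by auto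
    have "b' = 0"
    proof (rule ccontr)
      assume "b' \<noteq> 0"
      have "P (M - b' + k) = P k" if k: "k < b'" for k
      proof -
        have e: "P k = P (Q - b' + k)" using recursD[OF b'(2) k] by simp
        have "Q - b' + k < Q" using k b'(2) by (auto simp: recurs_def)
        then have "P (Q - b' + k) = P (M - Q + (Q - b' + k))" by (rule Q_border[symmetric])
        also have "M - Q + (Q - b' + k) = M - b' + k" using b'(2) QM by (simp add: recurs_def)
        finally show ?thesis using e by (simp only:)
      qed
      moreover have "b' < s" using b'(3) sM by linarith
      ultimately show False using no_border \<open>b' \<noteq> 0\<close> by blast
    qed
    moreover have "((c1 + Suc Q') mod Suc M + (s - 1)) mod Suc M = (c1 + Q) mod Suc M"
    proof -
      have "c1 + Suc Q' + (s - 1) = c1 + Q" using QQ' sM by simp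
      then show ?thesis by (simp only: mod_add_left_eq)
    qed
    ultimately show ?thesis using b'(1) by simp
  qed
  \<comment> \<open>Otherwise the power commutes with the rest of the word, and both are powers of a
    common word.\<close>
  have "\<exists>e. e < M - Q \<and> P (Q + e) \<noteq> P e"
  proof (rule ccontr)
    assume "\<not> ?thesis"
    then have per: "\<And>k. k < M - Q \<Longrightarrow> P (Q + k) = P k" by blast
    let ?p = "butlast t"
    define x y where "x = take Q ?p" and "y = take (M - Q) ?p"
    have l: "length ?p = M" by (rule length_butlast_t)
    have "drop Q ?p = y" using per l QM unfolding y_def
      by (intro nth_equalityI) (auto simp: nth_butlast_t)
    moreover have "drop (M - Q) ?p = x" using Q_border l QM unfolding x_def
      by (intro nth_equalityI) (auto simp: nth_butlast_t)
    ultimately have xy: "x @ y = ?p" "y @ x = ?p" by (metis append_take_drop_id x_def y_def)+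
    have "length x = Q" "length y = M - Q" using l QM by (simp_all add: x_def y_def)
    then have "x \<noteq> []" "y \<noteq> []" using QM QQ' sM by auto
    moreover obtain m n zs where z: "concat (replicate m zs) = x" "concat (replicate n zs) = y"
      using comm_append_are_replicate[of x y] xy by auto
    ultimately have "m \<noteq> 0" "n \<noteq> 0" by (auto intro!: notI)
    moreover have "?p = concat (replicate (m + n) zs)"
      using xy(1) z by (simp add: replicate_add)
    ultimately show False using nopow
      by (metis One_nat_def Suc_1 Suc_leI add_mono neq0_conv one_add_one)
  qed
  then obtain e where e: "e < M - Q \<and> P (Q + e) \<noteq> P e"
    and e_least: "\<And>k. k < e \<Longrightarrow> \<not> (k < M - Q \<and> P (Q + k) \<noteq> P k)"
    using exists_least_iff[of "\<lambda>e. e < M - Q \<and> P (Q + e) \<noteq> P e"] by blast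
  have QeM: "Q + e < M" using e by linarith
  have e_eq: "P (Q + k) = P k" if "k < e" for k using e_least[OF that] that e by simp
  have "recurs (Q + e) e" using e_eq QeM QQ' sM by (simp add: recurs_def)
  then have lt: "P (Q + e) < P e" using recurs_le[OF _ QeM] e le_neq_implies_less by blast
  \<comment> \<open>Up to index \<open>e\<close> the digits after \<open>Q\<close> copy the
    beginning, so \<open>b'\<close> is a border of the prefix of length \<open>e\<close> or equals
    \<open>e\<close>; hence \<open>P e \<le> P b'\<close>.\<close>
  have falls: "run (Q + e) < run b'" if b': "recurs (Q + e) b'" "b' \<le> e" for b'
  proof -
    have "P e \<le> P b'"
    proof (cases "b' = e")
      case False
      have "P (e - b' + k) = P k" if k: "k < b'" for k
      proof -
        have "P (Q + e - b' + k) = P k" using recursD[OF b'(1) k] by simp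
        moreover have "Q + e - b' + k = Q + (e - b' + k)" using b' by simp
        moreover have "e - b' + k < e" using b' k by simp
        ultimately show ?thesis using e_eq by metis
      qed
      then have "recurs e b'" using b' False QeM by (simp add: recurs_def)
      then show ?thesis using recurs_le QeM by simp
    qed simp
    then show ?thesis using lt b' QeM by (simp add: run_def)
  qed
  define Le where "Le = (adv ^^ e) LQ"
  have Q0: "recurs Q 0" using QM QQ' sM by (simp add: recurs_def)
  obtain d1 where d1: "branch ((c1 + Q + e) mod Suc M) Le d1" "run (Q + e) < run d1"
    and uLe: "u Le = Q + e"
    using branch_small_steps[OF br1 uLQ Q0, of e] QeM falls by (auto simp: Le_def mod_add_left_eq)
  \<comment> \<open>For \<open>e = 0\<close> the letter \<open>M\<close> itself loses now; otherwise
    it fell at the first step and \<open>e - 1\<close> steps remain.\<close>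
  obtain d2 where d2: "branch ((c2 + Q + e) mod Suc M) Le d2" "run (Q + e) < run d2"
  proof (cases e)
    case 0
    then show ?thesis using that[of M] br2 run_neq_M[of Q] QM by (simp add: Le_def)
  next
    case (Suc e')
    have f: "branch ((c2 + Suc Q) mod Suc M) (adv LQ) 0" "u (adv LQ) = Suc Q"
      using branch_fall[OF br2 uLQ] run_neq_M[of Q] QM by (auto simp: mod_Suc_eq)
    have "recurs (Suc Q) 0" "Suc Q + e' \<le> M" using QeM Suc by (auto simp: recurs_def)
    moreover have "(adv ^^ e') (adv LQ) = Le" using Suc by (simp add: Le_def funpow_swap1)
    ultimately obtain b' where "branch (((c2 + Suc Q) mod Suc M + e') mod Suc M) Le b'"
      "recurs (Q + e) b'" "b' \<le> e'"
      using branch_small_steps[OF f, of e'] Suc by auto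
    then show ?thesis using that[of b'] falls[of b'] Suc by (simp add: mod_add_left_eq)
  qed
  \<comment> \<open>Both letters fall to \<open>0\<close> at the same length, while equally many
    rotations keep the left letters distinct.\<close>
  have "branch ((c1 + (Q + e + 1)) mod Suc M) (adv Le) 0"
    "branch ((c2 + (Q + e + 1)) mod Suc M) (adv Le) 0"
    using branch_fall(1)[OF d1(1) uLe d1(2)] branch_fall(1)[OF d2(1) uLe d2(2)]
    by (simp_all add: mod_Suc_eq add.assoc)
  then show ?thesis using mod_add_neq[OF c(2,3,1)] by blast
qed

section \<open>Borders as words and the final equivalence\<close>

lemma border_iff:
  "(\<exists>v. v \<noteq> [] \<and> strict_prefix v (butlast t) \<and> strict_suffix v (butlast t)) \<longleftrightarrow> (\<exists>s. border s)"
proof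
  assume "\<exists>v. v \<noteq> [] \<and> strict_prefix v (butlast t) \<and> strict_suffix v (butlast t)"
  then obtain v where v: "v \<noteq> []" "strict_prefix v (butlast t)" "strict_suffix v (butlast t)"
    by blast
  define s where "s = length v"
  obtain x y where xy: "butlast t = v @ x" "butlast t = y @ v"
    using v by (metis strict_prefix_def strict_suffix_def prefix_def suffix_def)
  have "0 < length x" "0 < s" using v(1,2) xy(1) by (auto simp: s_def)
  moreover have "length (v @ x) = M" "length (y @ v) = M"
    using length_butlast_t xy by (simp_all only:)
  ultimately have M: "M = s + length x" "M = length y + s" "0 < s" "s < M"
    unfolding s_def length_append by linarith+
  have "P (M - s + k) = P k" if "k < s" for k
  proof -
    have "butlast t ! k = v ! k" using xy(1) that by (simp add: nth_append s_def)
    moreover have "butlast t ! (length y + k) = v ! k" using xy(2) that by (simp add: nth_append)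
    ultimately show ?thesis using nth_butlast_t[of k] nth_butlast_t[of "length y + k"] that M by simp
  qed
  then have "border s" using M by (auto simp: border_def recurs_def)
  then show "\<exists>s. border s" by blast
next
  assume "\<exists>s. border s"
  then obtain s where s: "0 < s" "s < M" "recurs M s" by (auto simp: border_def recurs_def)
  define v where "v = take s (butlast t)"
  have l: "length v = s" using s length_butlast_t by (simp add: v_def)
  have "v = drop (M - s) (butlast t)"
  proof (rule nth_equalityI)
    show "length v = length (drop (M - s) (butlast t))" using l s length_butlast_t by simp
    fix k assume "k < length v"
    then have k: "k < s" using l by simp
    have "drop (M - s) (butlast t) ! k = butlast t ! (M - s + k)" using length_butlast_t by simp
    also have "\<dots> = P (M - s + k)" using k s by (intro nth_butlast_t) simp
    also have "\<dots> = P k" using recursD[OF s(3) k] .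
    finally show "v ! k = drop (M - s) (butlast t) ! k" using k s nth_butlast_t[of k] by (simp add: v_def)
  qed
  then have "suffix v (butlast t)" using suffix_drop by metis
  moreover have "prefix v (butlast t)" by (simp add: v_def take_is_prefix)
  moreover have "v \<noteq> butlast t" using l s length_butlast_t by auto
  ultimately have "v \<noteq> [] \<and> strict_prefix v (butlast t) \<and> strict_suffix v (butlast t)"
    using l s by (auto simp: strict_prefix_def strict_suffix_def)
  then show "\<exists>v. v \<noteq> [] \<and> strict_prefix v (butlast t) \<and> strict_suffix v (butlast t)" by blast
qed

lemma affine_iff:
  "(\<exists>a b :: real. \<forall>n. real (complexity u n) = a * real n + b) \<longleftrightarrow>
     (\<exists>w k. k \<ge> 2 \<and> butlast t = concat (replicate k w)) \<or> \<not> (\<exists>s. border s)"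
proof
  assume "\<exists>a b :: real. \<forall>n. real (complexity u n) = a * real n + b"
  then show "(\<exists>w k. k \<ge> 2 \<and> butlast t = concat (replicate k w)) \<or> \<not> (\<exists>s. border s)"
    using affine_iff_no_collision exists_collision by blast
next
  assume "(\<exists>w k. k \<ge> 2 \<and> butlast t = concat (replicate k w)) \<or> \<not> (\<exists>s. border s)"
  \<comment> \<open>For an unbordered word this holds vacuously.\<close>
  then have "\<And>s k. \<lbrakk>border s; k < M - s\<rbrakk> \<Longrightarrow> P (s + k) = P k" using power_border by blast
  then have "\<not> (\<exists>a1 a2 L b. a1 \<noteq> a2 \<and> branch a1 L b \<and> branch a2 L b)"
    using no_collision by blast
  then show "\<exists>a b :: real. \<forall>n. real (complexity u n) = a * real n + b"
    using affine_iff_no_collision by blast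
qed

end

theorem theorem1:
  fixes \<beta> :: real and t :: "nat list"
  assumes "simple_parry \<beta> t" and "length t \<ge> 2"
  shows "(\<exists>a b :: real. \<forall>n. real (complexity (u_beta t) n) = a * real n + b)
    \<longleftrightarrow> (last t = 1 \<and>
         ((\<exists>w k. k \<ge> 2 \<and> butlast t = concat (replicate k w)) \<or>
          \<not> (\<exists>v. v \<noteq> [] \<and> strict_prefix v (butlast t) \<and> strict_suffix v (butlast t))))"
proof -
  interpret parry_digits t
    using assms by unfold_locales (auto simp: simple_parry_def)
  show ?thesis
  proof (cases "last t = 1")
    case True
    interpret unit_parry_digits t by unfold_locales (rule True)
    show ?thesis using affine_iff border_iff True by simp
  next
    case False
    then show ?thesis using last_one_if_affine by blast
  qed
qed

end
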